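(* Let $\mathcal{S}(x)\in x^2\mathbb{R}[[x]]$ have strictly negative quadratic coefficient, and let $x(y)$ be the local solution around the origin of $\frac{y^2}{2}=-\mathcal{S}(x)$ (the branch with $x(0)=0$ and positive linear coefficient). Suppose that $x(y)$ has only square-root type dominant singularities, located at the finitely many (at least one) regular points $(x,y)=(\tau_i,\rho_i)$, $i\in I$, of the curve $\frac{y^2}{2}=-\mathcal{S}(x)$. Then for every integer $R\ge 0$, as $n\to\infty$, $$[\hbar^n]\,\mathcal{F}[\mathcal{S}(x)](\hbar)=\sum_{k=0}^{R-1}\sum_{i\in I} w_{i,k}\,A_i^{-(n-k)}\,\Gamma(n-k)+\mathcal{O}\Big(\sum_{i\in I}|A_i|^{-n}\,\Gamma(n-R)\Big),$$ where $A_i=-\mathcal{S}(\tau_i)$ and $$w_{i,k}=\frac{1}{2\pi \mathrm{i}}\,[\hbar^k]\,\mathcal{F}\big[\mathcal{S}(x+\tau_i)-\mathcal{S}(\tau_i)\big](\hbar),$$ $\mathrm{i}$ being the imaginary unit in the prefactor.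
   Context: Formal integral: for a power series $\mathcal{S}(x)=-\frac{x^2}{2a}+V(x)$ with $V\in x^3\mathbb{C}[[x]]$ and $a\neq 0$, $$\mathcal{F}[\mathcal{S}(x)](\hbar)=\sqrt{a}\sum_{n=0}^\infty (a\hbar)^n(2n-1)!!\,[x^{2n}]e^{\frac1\hbar V(x)},$$ which is a well-defined formal power series in $\hbar$ (here $(-1)!!=1$). For $a>0$ the positive root $\sqrt a$ is taken. Dominant singularities: $x(y)$ is a power series with finite positive radius of convergence $r$; its dominant singularities are the singular points on the circle $|y|=r$. The hypothesis means: $x(y)$ extends analytically across every point of $|y|=r$ except the points $\rho_i$, $i\in I$; and near each $\rho_i$ (inside the disc) there is a convergent expansion $x(y)=\tau_i+\sum_{k\ge1}d_{i,k}(1-y/\rho_i)^{k/2}$ with $d_{i,1}\ne0$ (principal branch of the square root for $|y|<r$), i.e. $x(y)\to\tau_i$ as $y\to\rho_i$ and the singularity is of simple square-root type. Here $\mathcal{S}$ near $\tau_i$ means the analytic continuation of $\mathcal{S}$ along the image of the segment $[0,\rho_i)$ under $x(\cdot)$ (simply $\mathcal{S}$ itself if $\mathcal{S}$ is entire), so that $\rho_i^2/2=-\mathcal{S}(\tau_i)$; then $\mathcal{S}(x+\tau_i)-\mathcal{S}(\tau_i)=-\frac{x^2}{2a_i}+\cdots$ is a power series in $x$ with vanishing constant and linear term and nonzero quadratic coefficient. Branch convention: in $\mathcal{F}[\mathcal{S}(x+\tau_i)-\mathcal{S}(\tau_i)]$ the number $a_i$ need not be positive, and the branch of $\sqrt{a_i}$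 is the one determined by analytic continuation of $x(y)$, namely $\sqrt{a_i}=-\mathrm{i}\,d_{i,1}/(\sqrt2\,\rho_i)$. *)

theory Defs
  imports
    "HOL-Analysis.Analysis"
    "HOL-Computational_Algebra.Formal_Laurent_Series"
    "HOL-Library.Landau_Symbols"
begin

definition complex_fps :: "real fps \<Rightarrow> complex fps" where
  "complex_fps F = Abs_fps (\<lambda>n. complex_of_real (fps_nth F n))"

(* (2n - 1)!!, with (-1)!! = 1 *)
definition odd_double_fact :: "nat \<Rightarrow> nat" where
  "odd_double_fact n = (\<Prod>k<n. 2 * k + 1)"

(* exp (V(x) / hbar): a power series in x over the field of Laurent series in hbar. *)
definition exp_over_hbar :: "complex fps \<Rightarrow> complex fls fps" where
  "exp_over_hbar V =
     fps_exp 1 oo Abs_fps (\<lambda>m. inverse fls_X * fls_const (fps_nth V m))"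

(* The formal integral of S(x) = - x^2 / (2 a) + V(x), as a Laurent series in hbar = fls_X;
   the lemmas below show that the infinite sum converges (in the fls_X-adic metric) and that no
   negative powers of hbar occur. The argument s is the chosen square root of a. *)
definition formal_integral :: "complex \<Rightarrow> complex fps \<Rightarrow> complex fls" where
  "formal_integral s S =
     (let a = - 1 / (2 * fps_nth S 2);
          V = S + fps_const (1 / (2 * a)) * fps_X ^ 2
      in fls_const s *
         (\<Sum>n. (fls_const a * fls_X) ^ n * of_nat (odd_double_fact n)
               * fps_nth (exp_over_hbar V) (2 * n)))"

lemma exp_over_hbar_nth:
  "fps_nth (exp_over_hbar V) m =
     (\<Sum>j=0..m. fls_X_inv ^ j * fls_const (fps_nth (V ^ j) m / fact j))"
proof -
  define W where "W = Abs_fps (\<lambda>m. inverse fls_X * fls_const (fps_nth V m))"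
  have W: "fps_nth (W ^ j) m = fls_X_inv ^ j * fls_const (fps_nth (V ^ j) m)" for j m
  proof (induction j arbitrary: m)
    case 0
    show ?case by (cases "m = 0") auto
  next
    case (Suc j)
    have "fps_nth (W ^ Suc j) m =
        (\<Sum>i=0..m. fls_X_inv ^ Suc j *
           (fls_const (fps_nth V i) * fls_const (fps_nth (V ^ j) (m - i))))"
      by (simp add: fps_mult_nth W_def[symmetric] Suc)
         (simp add: W_def fls_inverse_X algebra_simps)
    also have "\<dots> = fls_X_inv ^ Suc j *
        (\<Sum>i=0..m. fls_const (fps_nth V i * fps_nth (V ^ j) (m - i)))"
      by (simp add: sum_distrib_left)
    also have "(\<Sum>i=0..m. fls_const (fps_nth V i * fps_nth (V ^ j) (m - i))) =
        fls_const (\<Sum>i=0..m. fps_nth V i * fps_nth (V ^ j) (m - i))"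
    proof -
      have "(\<Sum>i\<in>A. fls_const (g i)) = fls_const (\<Sum>i\<in>A. g i)"
        if "finite A" for A and g :: "nat \<Rightarrow> complex"
        using that by induction (auto simp: fls_plus_const)
      thus ?thesis by simp
    qed
    finally show ?case by (simp add: fps_mult_nth)
  qed
  have fact: "inverse (fact j) = fls_const (inverse (fact j) :: complex)" for j
  proof -
    have "fls_const (inverse (fact j)) * (fact j :: complex fls) = 1"
      by (metis fact_nonzero fls_const_1 fls_const_mult_const fls_of_nat left_inverse of_nat_fact)
    thus ?thesis by (simp add: inverse_unique mult.commute)
  qed
  show ?thesis
    unfolding exp_over_hbar_def W_def[symmetric] fps_compose_nth
    by (intro sum.cong refl) (simp add: W divide_inverse fact algebra_simps)
qed

lemma exp_over_hbar_nth_nth_eq_0: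
  assumes V: "fps_nth V 0 = 0" "fps_nth V 1 = 0" "fps_nth V 2 = 0"
    and k: "3 * k < - int m"
  shows "fls_nth (fps_nth (exp_over_hbar V) m) k = 0"
proof -
  have "fps_nth (V ^ j) m = 0" if "m < 3 * j" for j
  proof -
    have "fps_nth V i = 0" if "i < 3" for i
      using that V by (auto simp: less_Suc_eq numeral_3_eq_3 numeral_2_eq_2)
    hence "V = fps_X ^ 3 * fps_shift 3 V"
      by (auto simp: fps_eq_iff fps_X_power_mult_nth)
    hence "V ^ j = fps_X ^ (3 * j) * fps_shift 3 V ^ j"
      by (metis power_mult power_mult_distrib)
    thus ?thesis using that by (simp add: fps_X_power_mult_nth)
  qed
  thus ?thesis
    using k unfolding exp_over_hbar_nth fls_nth_sum
    by (intro sum.neutral) (auto simp: fls_X_inv_power_times_conv_shift)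
qed

lemma sums_fls:
  fixes f :: "nat \<Rightarrow> complex fls"
  assumes f: "\<And>n k. 3 * k < int n \<Longrightarrow> fls_nth (f n) k = 0"
  shows "f sums fps_to_fls (Abs_fps (\<lambda>k. \<Sum>n\<le>3*k. fls_nth (f n) (int k)))" (is "f sums ?L")
proof -
  have L: "fls_nth ?L k = (if k < 0 then 0 else \<Sum>n\<le>3 * nat k. fls_nth (f n) k)" for k
    by simp
  have ev: "dist (\<Sum>n<N. f n) ?L \<le> inverse (2 ^ M)" if N: "N > 3 * M" for N M
  proof (cases "(\<Sum>n<N. f n) = ?L")
    case False
    have "fls_nth ((\<Sum>n<N. f n) - ?L) k = 0" if "k < int M" for k
    proof (cases "k < 0")
      case True
      thus ?thesis by (simp add: fls_nth_sum f)
    next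
      case k: False
      have "(\<Sum>n<N. fls_nth (f n) k) = (\<Sum>n\<le>3 * nat k. fls_nth (f n) k)"
        using that N k by (intro sum.mono_neutral_right) (auto intro!: f)
      thus ?thesis using k by (simp add: fls_nth_sum)
    qed
    hence "fls_subdegree ((\<Sum>n<N. f n) - ?L) \<ge> int M"
      using False by (intro fls_subdegree_geI) auto
    thus ?thesis using False by (auto simp: dist_fls_def le_nat_iff field_simps)
  qed (simp add: dist_fls_def)
  show ?thesis unfolding sums_def
  proof (rule metric_LIMSEQ_I)
    fix e :: real assume "e > 0"
    then obtain M where M: "(1/2) ^ M < e" using real_arch_pow_inv[of e "1/2"] by auto
    show "\<exists>N0. \<forall>N\<ge>N0. dist (\<Sum>n<N. f n) ?L < e"
    proof (intro exI allI impI)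
      fix N assume "N \<ge> Suc (3 * M)"
      hence "dist (\<Sum>n<N. f n) ?L \<le> inverse (2 ^ M)" by (intro ev) auto
      also have "\<dots> < e" using M by (simp add: power_one_over inverse_eq_divide)
      finally show "dist (\<Sum>n<N. f n) ?L < e" .
    qed
  qed
qed

lemma formal_integral_converges:
  assumes S: "fps_nth S 0 = 0" "fps_nth S 1 = 0" "fps_nth S 2 \<noteq> 0"
  defines "a \<equiv> - 1 / (2 * fps_nth S 2)"
  defines "V \<equiv> S + fps_const (1 / (2 * a)) * fps_X ^ 2"
  defines "f \<equiv> \<lambda>n. (fls_const a * fls_X) ^ n * of_nat (odd_double_fact n)
                     * fps_nth (exp_over_hbar V) (2 * n)"
  shows "summable f"
    and "fls_nth (formal_integral s S) k =
           (if k < 0 then 0 else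
              s * (\<Sum>n\<le>3 * nat k. a ^ n * of_nat (odd_double_fact n) *
                     fls_nth (fps_nth (exp_over_hbar V) (2 * n)) (k - int n)))"
proof -
  have V: "fps_nth V 0 = 0" "fps_nth V 1 = 0" "fps_nth V 2 = 0"
    using S by (auto simp: V_def a_def fps_X_power_nth)
  have nth: "fls_nth (f n) k = a ^ n * of_nat (odd_double_fact n) *
      fls_nth (fps_nth (exp_over_hbar V) (2 * n)) (k - int n)" for n k
  proof -
    have "f n = fls_X ^ n * (fls_const (a ^ n * of_nat (odd_double_fact n))
                 * fps_nth (exp_over_hbar V) (2 * n))"
      by (simp add: f_def power_mult_distrib fls_const_power fls_of_nat algebra_simps
               flip: fls_const_mult_const)
    thus ?thesis by (simp add: fls_X_power_times_conv_shift)
  qed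
  have sums: "f sums fps_to_fls (Abs_fps (\<lambda>k. \<Sum>n\<le>3*k. fls_nth (f n) (int k)))"
    by (rule sums_fls) (simp add: nth exp_over_hbar_nth_nth_eq_0[OF V])
  show "summable f" using sums by (rule sums_summable)
  have "formal_integral s S = fls_const s * (\<Sum>n. f n)"
    by (simp add: formal_integral_def Let_def f_def V_def a_def)
  thus "fls_nth (formal_integral s S) k =
           (if k < 0 then 0 else
              s * (\<Sum>n\<le>3 * nat k. a ^ n * of_nat (odd_double_fact n) *
                     fls_nth (fps_nth (exp_over_hbar V) (2 * n)) (k - int n)))"
    by (simp add: sums_unique[OF sums, symmetric] nth)
qed

(* F is a power series with finite positive radius of convergence r whose singular points on the
   circle of radius r are the points rho i (i in I), each of simple square-root type. D i is the
   series in the local parameter (1 - y / rho i)^(1/2); fps_nth (D i) 0 is the limit value. *)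
definition dominant_sqrt_singularities ::
    "complex fps \<Rightarrow> real \<Rightarrow> 'i set \<Rightarrow> ('i \<Rightarrow> complex) \<Rightarrow> ('i \<Rightarrow> complex fps) \<Rightarrow> bool" where
  "dominant_sqrt_singularities F r I \<rho> D \<longleftrightarrow>
     0 < r \<and> fps_conv_radius F = ereal r \<and>
     finite I \<and> I \<noteq> {} \<and> inj_on \<rho> I \<and>
     (\<forall>z. norm z = r \<and> z \<notin> \<rho> ` I \<longrightarrow>
        (\<exists>e>0. \<exists>g. g holomorphic_on ball z e \<and>
           (\<forall>y \<in> ball z e \<inter> ball 0 r. g y = eval_fps F y))) \<and>
     (\<forall>i\<in>I. norm (\<rho> i) = r \<and>
        0 < fps_conv_radius (D i) \<and> fps_nth (D i) 1 \<noteq> 0 \<and>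
        (\<forall>\<^sub>F y in at (\<rho> i) within ball 0 r.
           eval_fps F y = eval_fps (D i) (csqrt (1 - y / \<rho> i))))"

(* Analytic continuation along a path by function elements: E t is the Taylor series at g t. *)
definition analytic_continuation_along ::
    "(real \<Rightarrow> complex) \<Rightarrow> complex fps \<Rightarrow> complex fps \<Rightarrow> bool" where
  "analytic_continuation_along g F G \<longleftrightarrow>
     (\<exists>E. E 0 = F \<and> E 1 = G \<and>
       (\<forall>t\<in>{0..1}. 0 < fps_conv_radius (E t) \<and>
          (\<forall>\<^sub>F s in at t within {0..1}.
             ereal (norm (g s - g t)) < fps_conv_radius (E t) \<and>
             (\<lambda>w. eval_fps (E t) (g s - g t + w)) has_fps_expansion E s)))"

(* The image of the segment from 0 to \<rho> under F, with \<tau> as its end point. *)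
definition image_segment :: "complex fps \<Rightarrow> complex \<Rightarrow> complex \<Rightarrow> real \<Rightarrow> complex" where
  "image_segment F \<rho> \<tau> t = (if t = 1 then \<tau> else eval_fps F (of_real t * \<rho>))"

end

theory Submission
  imports Defs "HOL-Complex_Analysis.Complex_Analysis"
begin

text \<open>
  By Lagrange inversion, the \<open>n\<close>-th coefficient of a formal integral is \<open>(2n + 1)!!\<close> times the
  coefficient of exponent \<open>2n + 1\<close> of the solution \<open>x(y)\<close>. Near a singularity \<open>\<rho>\<close>, analytic
  continuation of the functional equation shows that \<open>x(y) - \<tau>\<close> is the analogous solution \<open>Z(z)\<close>
  for the recentred action, evaluated at \<open>z = sqrt (y\<^sup>2 - \<rho>\<^sup>2)\<close>; only the odd powers of \<open>z\<close> are
  singular, and their coefficients are again coefficients of a formal integral.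
  The singular parts are matched by the functions
  \<open>sqrt (1 - y\<^sup>2)\<close> to the power \<open>2k + 1\<close> times \<open>1/2 + arcsin y / \<pi>\<close>: they are regular at \<open>- 1\<close>, and
  a first-order differential equation gives their odd coefficients in closed form, as multiples
  of \<open>\<Gamma>(n - k) / (2n + 1)!!\<close>. After subtracting them, sufficiently many derivatives are bounded on
  the disc, so Cauchy's inequality bounds the remaining coefficients (Darboux's method).
\<close>

unbundle no vec_syntax and fps_syntax

subsection \<open>Formal integrals and series reversion\<close>

text \<open>The equation involves \<open>y\<close> only through its square, so the natural singular
  parts are odd powers of the root of \<open>y^2 - \<rho>^2\<close>. As functions of
  \<open>y\<close> these are even: the odd coefficients, which are the ones the formal integral
  sees, all vanish, and the functions are just as singular at \<open>- \<rho>\<close>, which may be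
  a regular point or an unrelated singularity. The factor \<open>1/2 + arcsin y / \<pi>\<close>
  interpolates between 1 at \<open>y = 1\<close> and 0 at \<open>y = - 1\<close>, so it switches off
  the opposite point and at the same time supplies the odd part.

  The expansions at the singular points hold only inside the disc, with the principal root, so all
  estimates stay inside the disc and no contour leaves it. The price is that Cauchy's inequality and
  the bound on the double factorial together lose two powers of \<open>n\<close>; this is repaired
  by matching two more terms than the theorem asks for and moving the surplus into the
  error.\<close>

lemma fps_lagrange_inversion:
  fixes G Z :: "'a :: field_char_0 fps"
  assumes G: "G $ 0 \<noteq> 0" and Z: "Z oo (fps_X * G) = fps_X"
  shows "(inverse G ^ Suc n) $ n = of_nat (Suc n) * Z $ Suc n"
proof -
  define H Y where "H = inverse G" and "Y = fps_X * G"
  have HG: "H * G = 1" unfolding H_def by (rule inverse_mult_eq_1[OF G])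
  \<comment> \<open>As \<open>H\<close> is \<open>x / Y\<close>, this is the residue of
    \<open>Y' / Y^(m+1)\<close>. For positive \<open>m\<close> that is the derivative of a multiple
    of \<open>Y^(-m)\<close> and has no residue; the computation avoids Laurent series.\<close>
  have residue: "(H ^ Suc m * fps_deriv Y) $ m = (if m = 0 then 1 else 0)" for m
  proof (cases m)
    case (Suc l)
    have dH: "fps_deriv H * G = - (H * fps_deriv G)"
      using arg_cong[OF HG, of fps_deriv] by (simp add: eq_neg_iff_add_eq_0 add.commute)
    have dHG: "H ^ Suc m * fps_deriv G = - (H ^ l * fps_deriv H)"
    proof -
      have "H ^ Suc m * fps_deriv G = H ^ m * (H * fps_deriv G)" by simp
      also have "H * fps_deriv G = - (fps_deriv H * G)" by (simp add: dH)
      also have "H ^ m * \<dots> = - (H ^ m * G * fps_deriv H)" by (simp add: mult_ac)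
      also have "H ^ m * G = H ^ l * (H * G)" by (simp add: Suc algebra_simps)
      finally show ?thesis by (simp add: HG)
    qed
    have "H ^ Suc m * fps_deriv Y = H ^ m * (H * G) + fps_X * (H ^ Suc m * fps_deriv G)"
      by (simp add: Y_def algebra_simps)
    also have "\<dots> = H ^ m - fps_X * (H ^ l * fps_deriv H)"
      by (simp only: HG dHG) simp
    finally have *: "(H ^ Suc m * fps_deriv Y) $ m = (H ^ m) $ m - (H ^ l * fps_deriv H) $ l"
      by (simp add: Suc del: power_Suc)
    have "fps_deriv (H ^ m) = fps_const (of_nat m) * (H ^ l * fps_deriv H)"
      by (simp add: Suc fps_deriv_power mult_ac del: power_Suc of_nat_Suc)
    hence "of_nat m * (H ^ l * fps_deriv H) $ l = fps_deriv (H ^ m) $ l"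
      by (simp del: fps_deriv_nth)
    also have "\<dots> = of_nat m * (H ^ m) $ m" by (simp add: Suc del: power_Suc)
    finally have "(H ^ l * fps_deriv H) $ l = (H ^ m) $ m"
      unfolding Suc using of_nat_neq_0[of l, where 'a = 'a] by (simp del: of_nat_Suc power_Suc)
    thus ?thesis unfolding * by (simp add: Suc del: power_Suc)
  qed (use G in \<open>simp add: Y_def H_def\<close>)
  have Y0: "Y $ 0 = 0" by (simp add: Y_def)
  \<comment> \<open>The chain rule for \<open>Z oo Y\<close>. Multiplied by
    \<open>H ^ Suc n\<close>, it writes this power as a combination of the products in
    \<open>residue\<close>, of which only \<open>j = n\<close> survives.\<close>
  have "(fps_deriv Z oo Y) * fps_deriv Y = 1"
    using arg_cong[OF Z, of fps_deriv] Y0 by (simp add: fps_compose_deriv Y_def)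
  hence "H ^ Suc n = (fps_deriv Z oo Y) * (fps_deriv Y * H ^ Suc n)"
    by (metis mult.assoc mult_1)
  also have "\<dots> $ n = (\<Sum>j\<le>n. fps_deriv Z $ j * (Y ^ j * (fps_deriv Y * H ^ Suc n)) $ n)"
  proof -
    have "((fps_deriv Z oo Y) * Q) $ n = (\<Sum>j\<le>n. fps_deriv Z $ j * (Y ^ j * Q) $ n)" for Q
    proof -
      have "((fps_deriv Z oo Y) * Q) $ n =
          (\<Sum>i=0..n. (\<Sum>j=0..n. fps_deriv Z $ j * (Y ^ j) $ i) * Q $ (n - i))"
        unfolding fps_mult_nth fps_compose_nth
        by (intro sum.cong refl arg_cong2[of _ _ _ _ "(*)"] sum.mono_neutral_left)
           (auto intro!: startsby_zero_power_prefix[OF Y0, rule_format])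
      also have "\<dots> = (\<Sum>j=0..n. \<Sum>i=0..n. fps_deriv Z $ j * ((Y ^ j) $ i * Q $ (n - i)))"
        unfolding sum_distrib_right by (subst sum.swap) (simp add: mult.assoc)
      finally show ?thesis
        by (simp add: fps_mult_nth sum_distrib_left atLeast0AtMost)
    qed
    thus ?thesis .
  qed
  also have "\<dots> = (\<Sum>j\<le>n. fps_deriv Z $ j * (if j = n then 1 else 0))"
  proof (intro sum.cong refl arg_cong2[of _ _ _ _ "(*)"])
    fix j assume j: "j \<in> {..n}"
    have "G ^ j * H ^ Suc n = (H * G) ^ j * H ^ Suc (n - j)"
      using j by (simp add: power_mult_distrib algebra_simps flip: power_add power_Suc)
    hence "fps_X ^ j * (G ^ j * H ^ Suc n) * fps_deriv Y =
        fps_X ^ j * H ^ Suc (n - j) * fps_deriv Y"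
      by (simp only: HG power_one mult_1_left)
    hence *: "Y ^ j * (fps_deriv Y * H ^ Suc n) = fps_X ^ j * (H ^ Suc (n - j) * fps_deriv Y)"
      by (simp only: Y_def power_mult_distrib mult_ac)
    show "(Y ^ j * (fps_deriv Y * H ^ Suc n)) $ n = (if j = n then 1 else 0)"
      unfolding * using j by (auto simp add: fps_X_power_mult_nth residue simp del: power_Suc)
  qed
  also have "\<dots> = of_nat (Suc n) * Z $ Suc n"
    by (simp add: if_distrib[of "\<lambda>x. _ * x"] cong: if_cong)
  finally show ?thesis by (simp add: H_def)
qed

lemma odd_double_fact_Suc: "odd_double_fact (Suc n) = odd_double_fact n * (2 * n + 1)"
  by (simp add: odd_double_fact_def)

text \<open>The new factors are twice the half-integers \<open>k + 1/2, k + 3/2, ...\<close>. In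
  binomial form they turn the sum defining a formal integral into a binomial series.\<close>

lemma odd_double_fact_add:
  "of_nat (odd_double_fact (k + j)) =
     (of_nat (odd_double_fact k) * 2 ^ j * fact j * (-1) ^ j *
       ((- (of_nat k + 1 / 2)) gchoose j) :: 'a :: field_char_0)"
proof (induction j)
  case (Suc j)
  have "of_nat (odd_double_fact (k + Suc j)) =
      of_nat (odd_double_fact (k + j)) * (of_nat (2 * (k + j) + 1) :: 'a)"
    unfolding add_Suc_right odd_double_fact_Suc of_nat_mult ..
  also have "\<dots> = of_nat (odd_double_fact k) * 2 ^ Suc j * fact j * (-1) ^ Suc j *
       (((- (of_nat k + 1 / 2)) - of_nat j) * ((- (of_nat k + 1 / 2)) gchoose j))"
    unfolding Suc.IH by (simp add: algebra_simps)
  also have "((- (of_nat k + 1 / 2 :: 'a)) - of_nat j) * ((- (of_nat k + 1 / 2)) gchoose j) =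
      of_nat (Suc j) * ((- (of_nat k + 1 / 2)) gchoose Suc j)"
    using gbinomial_mult_1[of "- (of_nat k + 1 / 2) :: 'a" j]
    by (simp only: left_diff_distrib) simp
  finally show ?case by (simp add: algebra_simps)
qed simp

text \<open>If \<open>Y\<close> is the inverse of \<open>Z\<close>, then
  \<open>S = - Y^2 / 2\<close> and \<open>V = x^2 H / (2 a)\<close> with
  \<open>1 - H = a (Y / x)^2\<close>. The sum over the powers of \<open>V\<close> is then the
  binomial series of \<open>(1 - H)^(- k - 1/2)\<close>, an odd power of \<open>x / Y\<close>, whose
  coefficient Lagrange inversion provides.\<close>

lemma formal_integral_nth_eq_reversion:
  assumes S: "S $ 0 = 0" "S $ 1 = 0" "S $ 2 \<noteq> 0"
    and Z: "Z $ 0 = 0" "Z $ 1 \<noteq> 0" "S oo Z = - (fps_const (1 / 2) * fps_X ^ 2)"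
  shows "fls_nth (formal_integral (Z $ 1) S) (int k) =
           of_nat (odd_double_fact (Suc k)) * Z $ (2 * k + 1)"
proof -
  define a where "a = - 1 / (2 * S $ 2)"
  define V where "V = S + fps_const (1 / (2 * a)) * fps_X ^ 2"
  define Y where "Y = fps_inv Z"
  define G where "G = fps_shift 1 Y"
  define H where "H = 1 - fps_const a * G ^ 2"
  have Y0: "Y $ 0 = 0" and Y1: "Y $ 1 = 1 / Z $ 1"
    using Z by (simp_all add: Y_def fps_inv_def)
  have Y: "Y = fps_X * G"
    using Y0 by (auto simp: fps_eq_iff G_def)
  have ZY: "Z oo Y = fps_X" unfolding Y_def using Z by (intro fps_inv_right) auto
  have "S = S oo (Z oo Y)" by (simp add: ZY)
  also have "\<dots> = (S oo Z) oo Y" using Z Y0 by (simp add: fps_compose_assoc)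
  also have "\<dots> = - (fps_const (1 / 2) * Y ^ 2)"
    using Y0 by (simp add: Z fps_compose_uminus fps_compose_mult_distrib
         fps_compose_power[symmetric])
  finally have SY: "S = - (fps_const (1 / 2) * Y ^ 2)" .
  have G0: "G $ 0 = 1 / Z $ 1" using Y1 by (simp add: G_def)
  have aZ: "a = (Z $ 1)\<^sup>2"
  proof -
    have "S $ 2 = - (1 / 2) * (1 / Z $ 1) ^ 2"
      by (subst SY) (simp add: Y fps_mult_nth power2_eq_square G0 power_mult_distrib
             numeral_2_eq_2 fps_X_power_mult_nth)
    thus ?thesis by (simp add: a_def power_divide)
  qed
  have a: "a \<noteq> 0" using Z(2) by (simp add: aZ)
  have V: "V = fps_const (1 / (2 * a)) * (fps_X ^ 2 * H)"
  proof -
    have "fps_const (1 / (2 * a)) * fps_const a = fps_const (1 / 2)" using a by simp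
    hence "fps_const (1 / (2 * a)) * (fps_X ^ 2 * H) =
        fps_const (1 / (2 * a)) * fps_X ^ 2 - fps_const (1 / 2) * (fps_X ^ 2 * G ^ 2)"
      unfolding H_def by (simp only: right_diff_distrib mult_1_right mult.assoc[symmetric])
        (simp add: mult.commute[of _ "fps_const a"] mult.assoc[symmetric])
    also have "\<dots> = fps_const (1 / (2 * a)) * fps_X ^ 2 + S"
      by (subst SY) (simp add: Y power_mult_distrib)
    finally show ?thesis by (simp add: V_def)
  qed
  have Vj: "(V ^ j) $ (2 * (k + j)) = (1 / (2 * a)) ^ j * (H ^ j) $ (2 * k)" for j
    by (simp add: V power_mult_distrib fps_const_power fps_X_power_mult_nth flip: power_mult)
  have H0: "H $ 0 = 0" using Z(2) by (simp add: H_def G0 aZ power_divide fps_power_zeroth)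
  \<comment> \<open>The exponent is a half-integer, so the two sides are compared through their
    squares; both have constant coefficient 1, which settles the sign.\<close>
  have B: "fps_binomial (- (of_nat k + 1 / 2)) oo (- H) =
      fps_const ((1 / Z $ 1) ^ (2 * k + 1)) * inverse G ^ (2 * k + 1)" (is "?B = ?C")
  proof -
    define E where "E = fps_const (Z $ 1) * G"
    have E2: "1 - H = E\<^sup>2"
      by (simp add: H_def E_def aZ power_mult_distrib fps_const_power)
    have E0: "E $ 0 = 1" using Z(2) by (simp add: E_def G0)
    have "?B ^ 2 = fps_binomial (- of_nat (2 * k + 1)) oo (- H)"
    proof -
      have *: "of_nat 2 * (- (of_nat k + 1 / 2 :: complex)) = - of_nat (2 * k + 1)"
        by simp
      show ?thesis using H0 by (subst fps_compose_power) (simp_all only: fps_binomial_power *, simp)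
    qed
    also have "fps_binomial (- of_nat (2 * k + 1)) = inverse ((1 + fps_X :: complex fps) ^ (2 * k + 1))"
      by (rule fps_binomial_minus_of_nat)
    also have "\<dots> oo (- H) = inverse ((1 - H) ^ (2 * k + 1))"
      using H0 by (subst fps_inverse_compose)
        (auto simp: fps_compose_power[symmetric] fps_compose_add_distrib fps_power_zeroth
           simp del: power_Suc)
    finally have "?B ^ 2 = inverse (E ^ (2 * k + 1)) ^ 2"
      by (simp only: E2 fps_inverse_power power_commutes flip: power_mult) (simp only: mult_ac)
    moreover have "?B $ 0 = 1" by simp
    moreover have "inverse (E ^ (2 * k + 1)) $ 0 = 1"
      using E0 by (simp add: fps_power_zeroth)
    ultimately have "?B = inverse (E ^ (2 * k + 1))"
      by (metis fps_neg_nth one_neq_neg_one power2_eq_iff)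
    also have "\<dots> = ?C"
      by (simp add: E_def power_mult_distrib fps_inverse_mult fps_inverse_power fps_const_power
          fps_const_inverse power_one_over inverse_eq_divide del: power_Suc)
    finally show ?thesis .
  qed
  have "fls_nth (formal_integral (Z $ 1) S) (int k) =
      Z $ 1 * (\<Sum>n\<le>3 * k. a ^ n * of_nat (odd_double_fact n) *
        (\<Sum>j\<le>2 * n. if int j = int n - int k then (V ^ j) $ (2 * n) / fact j else 0))"
    unfolding formal_integral_converges(2)[OF S] a_def[symmetric] V_def[symmetric]
    by (simp add: exp_over_hbar_nth fls_nth_sum fls_X_inv_power_times_conv_shift atLeast0AtMost
           algebra_simps if_distrib cong: if_cong)
  \<comment> \<open>The \<open>j\<close>-th term of the exponential carries
    \<open>hbar^(n - j)\<close>, so only \<open>j = n - k\<close> counts. The bound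
    \<open>k + 2 * k\<close> becomes \<open>2 * k\<close> after the shift, which is the range of the
    composition coefficient.\<close>
  also have "\<dots> = Z $ 1 * (\<Sum>n\<in>{k..k + 2 * k}. a ^ n * of_nat (odd_double_fact n) *
        ((V ^ (n - k)) $ (2 * n) / fact (n - k)))"
  proof (rule arg_cong[where f = "\<lambda>x. Z $ 1 * x"], rule sum.mono_neutral_cong_right, goal_cases)
    case 3
    show ?case
    proof
    fix n assume "n \<in> {..3 * k} - {k..k + 2 * k}"
    thus "a ^ n * of_nat (odd_double_fact n) *
        (\<Sum>j\<le>2 * n. if int j = int n - int k then (V ^ j) $ (2 * n) / fact j else 0) = 0"
      by (auto intro!: sum.neutral)
    qed
  next
    case (4 n)
    hence n: "n \<in> {k..k + 2 * k}" .
    have "(\<Sum>j\<le>2 * n. if int j = int n - int k then (V ^ j) $ (2 * n) / fact j else 0) =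
        (\<Sum>j\<le>2 * n. if j = n - k then (V ^ j) $ (2 * n) / fact j else 0)"
      using n by (intro sum.cong refl) auto
    also have "\<dots> = (V ^ (n - k)) $ (2 * n) / fact (n - k)"
      by (simp add: sum.delta)
    finally show ?case by simp
  qed auto
  also have "(\<Sum>n\<in>{k..k + 2 * k}. a ^ n * of_nat (odd_double_fact n) *
        ((V ^ (n - k)) $ (2 * n) / fact (n - k))) =
      (\<Sum>j=0..2 * k. a ^ (k + j) * of_nat (odd_double_fact (k + j)) *
        ((V ^ j) $ (2 * (k + j)) / fact j))"
    by (rule sum.reindex_bij_witness[of _ "\<lambda>j. k + j" "\<lambda>n. n - k"]) auto
  also have "\<dots> = (\<Sum>j=0..2 * k. (a ^ k * of_nat (odd_double_fact k)) *
        (((- (of_nat k + 1 / 2)) gchoose j) * ((- H) ^ j) $ (2 * k)))"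
  proof (intro sum.cong refl)
    fix j
    have "(- H) ^ j = fps_const ((-1) ^ j) * H ^ j"
      by (simp add: power_minus[of H] fps_const_power[symmetric] fps_const_neg[symmetric]
               del: fps_const_neg)
    thus "a ^ (k + j) * of_nat (odd_double_fact (k + j)) * ((V ^ j) $ (2 * (k + j)) / fact j) =
       (a ^ k * of_nat (odd_double_fact k)) *
        (((- (of_nat k + 1 / 2)) gchoose j) * ((- H) ^ j) $ (2 * k))"
      unfolding Vj odd_double_fact_add using a
      by (simp add: power_add power_mult_distrib field_simps)
  qed
  also have "\<dots> = (a ^ k * of_nat (odd_double_fact k)) * ?B $ (2 * k)"
    by (simp add: fps_compose_nth sum_distrib_left)
  also have "?B $ (2 * k) = (1 / Z $ 1) ^ (2 * k + 1) * (of_nat (2 * k + 1) * Z $ (2 * k + 1))"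
    unfolding B using fps_lagrange_inversion[of G Z "2 * k"] G0 Z(2) ZY
    by (simp add: Y del: power_Suc)
  also have "Z $ 1 * ((a ^ k * of_nat (odd_double_fact k)) * \<dots>) =
      (Z $ 1 * (a ^ k * (1 / Z $ 1) ^ (2 * k + 1))) *
      (of_nat (odd_double_fact k) * of_nat (2 * k + 1) * Z $ (2 * k + 1))"
    by (simp only: mult_ac)
  also have "Z $ 1 * (a ^ k * (1 / Z $ 1) ^ (2 * k + 1)) = 1"
    using Z(2) by (simp add: aZ power_mult[symmetric] power_one_over field_simps)
  finally show ?thesis by (simp only: odd_double_fact_Suc of_nat_mult mult_1_left)
qed

subsection \<open>Coefficients of functions with square-root singularities\<close>

text \<open>An arbitrary \<open>p\<close> in place of \<open>eval_fps P\<close> keeps sums and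
  compositions free of conditions on radii. Equality is asked for only inside the disc, where the
  principal root is analytic.\<close>

definition sqrt_expansion :: "(complex \<Rightarrow> complex) \<Rightarrow> complex \<Rightarrow> complex fps \<Rightarrow> bool" where
  "sqrt_expansion f \<zeta> P \<longleftrightarrow>
     (\<exists>p. p has_fps_expansion P \<and>
       (\<forall>\<^sub>F y in at \<zeta> within ball 0 (norm \<zeta>). f y = p (csqrt (1 - y / \<zeta>))))"

text \<open>The principal root jumps across the negative reals, but its norm is continuous, which is
  enough for the limit 0.\<close>

lemma tendsto_csqrt_local_parameter:
  assumes "\<zeta> \<noteq> 0"
  shows "((\<lambda>y. csqrt (1 - y / \<zeta>)) \<longlongrightarrow> 0) (at \<zeta> within A)"
proof (rule tendsto_norm_zero_cancel)
  have "((\<lambda>y. sqrt (norm (1 - y / \<zeta>))) \<longlongrightarrow> sqrt (norm (1 - \<zeta> / \<zeta>))) (at \<zeta> within A)"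
    using assms by (intro tendsto_intros) auto
  thus "((\<lambda>y. norm (csqrt (1 - y / \<zeta>))) \<longlongrightarrow> 0) (at \<zeta> within A)"
    using assms by simp
qed

lemma Re_local_parameter_pos:
  assumes "norm y < norm (\<zeta> :: complex)"
  shows "Re (1 - y / \<zeta>) > 0"
proof -
  have "norm (y / \<zeta>) < 1" using assms by (auto simp: norm_divide divide_simps split: if_splits)
  thus ?thesis using complex_Re_le_cmod[of "y / \<zeta>"] by simp
qed

lemma sqrt_expansionI:
  assumes "p has_fps_expansion P"
    and "\<forall>\<^sub>F y in at \<zeta> within ball 0 (norm \<zeta>). f y = p (csqrt (1 - y / \<zeta>))"
  shows "sqrt_expansion f \<zeta> P"
  using assms unfolding sqrt_expansion_def by blast

lemma sqrt_expansion_cmult: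
  assumes "sqrt_expansion f \<zeta> P"
  shows "sqrt_expansion (\<lambda>y. c * f y) \<zeta> (fps_const c * P)"
proof -
  obtain p where p: "p has_fps_expansion P"
      "\<forall>\<^sub>F y in at \<zeta> within ball 0 (norm \<zeta>). f y = p (csqrt (1 - y / \<zeta>))"
    using assms unfolding sqrt_expansion_def by blast
  show ?thesis
    by (rule sqrt_expansionI[OF has_fps_expansion_cmult_left[OF p(1), of c]])
       (use p(2) in eventually_elim, simp)
qed

lemma sqrt_expansion_diff:
  assumes "sqrt_expansion f \<zeta> P" "sqrt_expansion g \<zeta> Q"
  shows "sqrt_expansion (\<lambda>y. f y - g y) \<zeta> (P - Q)"
proof -
  obtain p where p: "p has_fps_expansion P"
      "\<forall>\<^sub>F y in at \<zeta> within ball 0 (norm \<zeta>). f y = p (csqrt (1 - y / \<zeta>))"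
    using assms(1) unfolding sqrt_expansion_def by blast
  obtain q where q: "q has_fps_expansion Q"
      "\<forall>\<^sub>F y in at \<zeta> within ball 0 (norm \<zeta>). g y = q (csqrt (1 - y / \<zeta>))"
    using assms(2) unfolding sqrt_expansion_def by blast
  show ?thesis
    by (rule sqrt_expansionI[OF has_fps_expansion_diff[OF p(1) q(1)]])
       (use p(2) q(2) in eventually_elim, simp)
qed

lemma sqrt_expansion_sum:
  assumes "finite A" "\<And>i. i \<in> A \<Longrightarrow> sqrt_expansion (f i) \<zeta> (P i)"
  shows "sqrt_expansion (\<lambda>y. \<Sum>i\<in>A. f i y) \<zeta> (\<Sum>i\<in>A. P i)"
proof -
  have "\<forall>i\<in>A. \<exists>p. p has_fps_expansion P i \<and>
      (\<forall>\<^sub>F y in at \<zeta> within ball 0 (norm \<zeta>). f i y = p (csqrt (1 - y / \<zeta>)))"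
    using assms(2) unfolding sqrt_expansion_def by blast
  then obtain p where p: "\<And>i. i \<in> A \<Longrightarrow> p i has_fps_expansion P i"
      "\<And>i. i \<in> A \<Longrightarrow> \<forall>\<^sub>F y in at \<zeta> within ball 0 (norm \<zeta>). f i y = p i (csqrt (1 - y / \<zeta>))"
    by metis
  show ?thesis
  proof (rule sqrt_expansionI)
    show "(\<lambda>u. \<Sum>i\<in>A. p i u) has_fps_expansion (\<Sum>i\<in>A. P i)"
      by (intro has_fps_expansion_sum p)
    have "\<forall>\<^sub>F y in at \<zeta> within ball 0 (norm \<zeta>). \<forall>i\<in>A. f i y = p i (csqrt (1 - y / \<zeta>))"
      using assms(1) p(2) by (intro eventually_ball_finite) auto
    thus "\<forall>\<^sub>F y in at \<zeta> within ball 0 (norm \<zeta>).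
        (\<Sum>i\<in>A. f i y) = (\<Sum>i\<in>A. p i (csqrt (1 - y / \<zeta>)))"
      by eventually_elim simp
  qed
qed

text \<open>Substituting \<open>y = \<zeta> - \<zeta> u^2\<close> gives only even powers of
  \<open>u\<close>. Regular points of the circle are thus treated like singular ones, with nothing
  to cancel.\<close>

lemma sqrt_expansion_holomorphic:
  assumes "\<zeta> \<noteq> 0" "0 < e" "g holomorphic_on ball \<zeta> e"
    and "\<And>y. y \<in> ball \<zeta> e \<inter> ball 0 (norm \<zeta>) \<Longrightarrow> f y = g y"
  obtains P where "sqrt_expansion f \<zeta> P" "\<And>n. odd n \<Longrightarrow> P $ n = 0"
proof -
  have "g analytic_on {\<zeta>}"
    using assms(2,3) by (meson analytic_at centre_in_ball open_ball)
  then obtain G where G: "(\<lambda>w. g (\<zeta> + w)) has_fps_expansion G"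
    using analytic_at_imp_has_fps_expansion by blast
  define P where "P = G oo (fps_const (- \<zeta>) * fps_X ^ 2)"
  have "((\<lambda>w. g (\<zeta> + w)) \<circ> (\<lambda>u. - \<zeta> * u ^ 2)) has_fps_expansion P"
    unfolding P_def
    using has_fps_expansion_cmult_left[OF has_fps_expansion_fps_X_power[of 2], of "- \<zeta>"]
    by (intro has_fps_expansion_compose G) simp_all
  moreover have "\<forall>\<^sub>F y in at \<zeta> within ball 0 (norm \<zeta>). y \<in> ball \<zeta> e \<inter> ball 0 (norm \<zeta>)"
    using assms(2) unfolding eventually_at by (intro exI[of _ e]) (auto simp: dist_commute)
  hence "\<forall>\<^sub>F y in at \<zeta> within ball 0 (norm \<zeta>).
      f y = ((\<lambda>w. g (\<zeta> + w)) \<circ> (\<lambda>u. - \<zeta> * u ^ 2)) (csqrt (1 - y / \<zeta>))"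
    by eventually_elim (use assms(1,4) in \<open>auto simp: algebra_simps\<close>)
  ultimately have "sqrt_expansion f \<zeta> P" by (rule sqrt_expansionI)
  moreover have "P $ n = 0" if "odd n" for n
  proof -
    have "((fps_const (- \<zeta>) * fps_X ^ 2) ^ i) $ n = 0" for i
      using that by (auto simp: power_mult_distrib fps_const_power fps_X_power_nth
             simp del: fps_const_neg simp flip: power_mult)
    thus ?thesis by (simp only: P_def fps_compose_nth) simp
  qed
  ultimately show ?thesis using that by blast
qed

text \<open>Differentiation in \<open>y\<close> lowers the exponents of the local parameter by two, so as long as
  the coefficient of exponent one vanishes, the derivative stays bounded.\<close>

lemma sqrt_expansion_deriv:
  assumes \<zeta>: "\<zeta> \<noteq> 0" and f: "sqrt_expansion f \<zeta> P" and P1: "P $ 1 = 0"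
  shows "sqrt_expansion (deriv f) \<zeta> (fps_const (- 1 / (2 * \<zeta>)) * fps_shift 1 (fps_deriv P))"
proof -
  let ?B = "ball 0 (norm \<zeta>)" and ?u = "\<lambda>y. csqrt (1 - y / \<zeta>)"
  obtain p where p: "p has_fps_expansion P"
      and fp: "\<forall>\<^sub>F y in at \<zeta> within ?B. f y = p (?u y)"
    using f unfolding sqrt_expansion_def by blast
  obtain s where s: "open s" "0 \<in> s" "p holomorphic_on s"
    using has_fps_expansion_imp_holomorphic[OF p] by metis
  \<comment> \<open>The quotient \<open>p' / u\<close> has a removable singularity because
    \<open>P $ 1 = 0\<close>; the case value fills it. The zero series has subdegree 0, so the shift
    rule does not cover it and it needs its own case.\<close>
  define q where "q = (\<lambda>u. if u = 0 then fps_deriv P $ 1 else deriv p u / u ^ 1)"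
  have q: "q has_fps_expansion fps_shift 1 (fps_deriv P)"
  proof (cases "fps_deriv P = 0")
    case False
    hence "1 \<le> subdegree (fps_deriv P)" using P1 by (intro subdegree_geI) auto
    thus ?thesis unfolding q_def
      by (intro has_fps_expansion_shift has_fps_expansion_deriv p) auto
  next
    case True
    have "\<forall>\<^sub>F u in nhds 0. deriv p u = 0"
      using has_fps_expansion_deriv[OF p] unfolding True has_fps_expansion_0_iff .
    hence "\<forall>\<^sub>F u in nhds 0. q u = 0"
      by eventually_elim (auto simp: q_def True)
    thus ?thesis by (simp add: True has_fps_expansion_0_iff)
  qed
  have "\<forall>\<^sub>F y in at \<zeta> within ?B. ?u y \<in> s"
    by (rule topological_tendstoD[OF tendsto_csqrt_local_parameter[OF \<zeta>] s(1,2)])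
  with fp have "\<forall>\<^sub>F y in at \<zeta> within ?B. f y = p (?u y) \<and> ?u y \<in> s"
    by eventually_elim simp
  then obtain d where d: "d > 0"
      "\<And>y. y \<in> ?B \<Longrightarrow> y \<noteq> \<zeta> \<Longrightarrow> dist y \<zeta> < d \<Longrightarrow> f y = p (?u y) \<and> ?u y \<in> s"
    unfolding eventually_at by blast
  have "deriv f y = - 1 / (2 * \<zeta>) * q (?u y)" if y: "y \<in> ?B \<inter> ball \<zeta> d" for y
  proof -
    have fU: "f x = p (?u x)" if "x \<in> ?B \<inter> ball \<zeta> d" for x
      using d(2)[of x] that by (auto simp: dist_commute)
    have us: "?u y \<in> s" using d(2)[of y] y by (auto simp: dist_commute)
    have Re: "Re (1 - y / \<zeta>) > 0" using y by (intro Re_local_parameter_pos) simp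
    hence u0: "?u y \<noteq> 0" by auto
    have "((\<lambda>x. p (?u x)) has_field_derivative
             deriv p (?u y) * (- 1 / \<zeta> * (1 / (2 * ?u y)))) (at y)"
    proof -
      have "(p has_field_derivative deriv p (?u y)) (at (?u y))"
        using s us holomorphic_derivI by blast
      moreover have "1 - y / \<zeta> \<notin> \<real>\<^sub>\<le>\<^sub>0" using Re by (auto simp: complex_nonpos_Reals_iff)
      hence "(?u has_field_derivative - 1 / \<zeta> * (1 / (2 * ?u y))) (at y)"
        using \<zeta> by (auto intro!: derivative_eq_intros simp: field_simps)
      ultimately show ?thesis by (rule DERIV_chain2)
    qed
    hence "(f has_field_derivative
             deriv p (?u y) * (- 1 / \<zeta> * (1 / (2 * ?u y)))) (at y)"
      by (rule has_field_derivative_transform_within_open[of _ _ _ "?B \<inter> ball \<zeta> d"])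
         (use y fU in auto)
    hence "deriv f y = deriv p (?u y) * (- 1 / \<zeta> * (1 / (2 * ?u y)))"
      by (rule DERIV_imp_deriv)
    moreover have "q (?u y) = deriv p (?u y) / ?u y"
      unfolding q_def using u0 by (simp only: if_False power_one_right)
    ultimately show ?thesis by simp
  qed
  hence "\<forall>\<^sub>F y in at \<zeta> within ?B. deriv f y = - 1 / (2 * \<zeta>) * q (?u y)"
    unfolding eventually_at using d(1) by (intro exI[of _ d]) (auto simp: dist_commute)
  thus ?thesis
    by (rule sqrt_expansionI[OF has_fps_expansion_cmult_left[OF q]])
qed

text \<open>A derivative moves the exponent \<open>2 j + 3\<close> to \<open>2 j + 1\<close>, so
  every vanishing odd coefficient pays for one derivative.\<close>

lemma sqrt_expansion_higher_deriv:
  assumes "\<zeta> \<noteq> 0" "sqrt_expansion f \<zeta> P" "\<And>j. j < K \<Longrightarrow> P $ (2 * j + 1) = 0"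
  shows "\<exists>Q. sqrt_expansion ((deriv ^^ K) f) \<zeta> Q"
  using assms(2,3)
proof (induction K arbitrary: f P)
  case (Suc K)
  let ?Q = "fps_const (- 1 / (2 * \<zeta>)) * fps_shift 1 (fps_deriv P)"
  have "sqrt_expansion (deriv f) \<zeta> ?Q"
    using sqrt_expansion_deriv[OF assms(1) Suc.prems(1)] Suc.prems(2)[of 0] by simp
  moreover have "?Q $ (2 * j + 1) = 0" if "j < K" for j
    using Suc.prems(2)[of "Suc j"] that by simp
  ultimately have "\<exists>Q. sqrt_expansion ((deriv ^^ K) (deriv f)) \<zeta> Q"
    by (rule Suc.IH)
  thus ?case by (simp add: funpow_Suc_right del: funpow.simps)
qed auto

section \<open>Boundedness on the disc and the resulting coefficient bounds\<close>

lemma sqrt_expansion_imp_bounded: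
  assumes "\<zeta> \<noteq> 0" "sqrt_expansion f \<zeta> P"
  obtains d B where "d > 0" "\<And>y. y \<in> ball \<zeta> d \<inter> ball 0 (norm \<zeta>) \<Longrightarrow> norm (f y) \<le> B"
proof -
  let ?u = "\<lambda>y. csqrt (1 - y / \<zeta>)"
  obtain p where p: "p has_fps_expansion P"
      and fp: "\<forall>\<^sub>F y in at \<zeta> within ball 0 (norm \<zeta>). f y = p (?u y)"
    using assms unfolding sqrt_expansion_def by blast
  have "isCont p 0" using has_fps_expansion_imp_continuous[OF p] by simp
  hence "((\<lambda>y. p (?u y)) \<longlongrightarrow> p 0) (at \<zeta> within ball 0 (norm \<zeta>))"
    using tendsto_csqrt_local_parameter[OF assms(1)] isCont_tendsto_compose by blast
  hence "\<forall>\<^sub>F y in at \<zeta> within ball 0 (norm \<zeta>). dist (p (?u y)) (p 0) < 1"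
    by (rule tendstoD) simp
  with fp have "\<forall>\<^sub>F y in at \<zeta> within ball 0 (norm \<zeta>). norm (f y) \<le> norm (p 0) + 1"
  proof eventually_elim
    case (elim y)
    thus ?case using norm_triangle_ineq2[of "p (?u y)" "p 0"] by (simp add: dist_norm)
  qed
  then obtain d where "d > 0"
      "\<forall>y\<in>ball 0 (norm \<zeta>). y \<noteq> \<zeta> \<and> dist y \<zeta> < d \<longrightarrow> norm (f y) \<le> norm (p 0) + 1"
    unfolding eventually_at by blast
  thus ?thesis by (intro that[of d "norm (p 0) + 1"]) (auto simp: dist_commute)
qed

text \<open>Compactness of the closed disc: continuity gives bounds near interior points, the
  hypothesis near the circle, and finitely many neighbourhoods suffice.\<close>

lemma bounded_on_ball_if_locally_bounded:
  fixes g :: "complex \<Rightarrow> complex"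
  assumes g: "continuous_on (ball 0 r) g"
    and bd: "\<And>\<zeta>. norm \<zeta> = r \<Longrightarrow>
      \<exists>d>0. \<exists>B. \<forall>y\<in>ball \<zeta> d \<inter> ball 0 r. norm (g y) \<le> B"
  obtains B where "B > 0" "\<And>y. y \<in> ball 0 r \<Longrightarrow> norm (g y) \<le> B"
proof -
  have "\<exists>d>0. \<exists>B. \<forall>y\<in>ball \<zeta> d \<inter> ball 0 r. norm (g y) \<le> B" if "\<zeta> \<in> cball 0 r" for \<zeta>
  proof (cases "norm \<zeta> = r")
    case False
    hence "\<zeta> \<in> ball 0 r" using that by auto
    hence "isCont g \<zeta>" using g by (simp add: continuous_on_eq_continuous_at)
    then obtain d where "d > 0" "\<forall>y. dist y \<zeta> < d \<longrightarrow> dist (g y) (g \<zeta>) < 1"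
      unfolding continuous_at_eps_delta by (meson zero_less_one)
    hence "\<forall>y\<in>ball \<zeta> d \<inter> ball 0 r. norm (g y) \<le> norm (g \<zeta>) + 1"
      by (smt (verit) IntD1 dist_commute dist_norm mem_ball norm_triangle_sub)
    thus ?thesis using \<open>d > 0\<close> by blast
  qed (use bd in auto)
  then obtain d B where d: "\<And>\<zeta>. \<zeta> \<in> cball 0 r \<Longrightarrow> d \<zeta> > 0"
    and B: "\<And>\<zeta> y. \<zeta> \<in> cball 0 r \<Longrightarrow> y \<in> ball \<zeta> (d \<zeta>) \<inter> ball 0 r \<Longrightarrow> norm (g y) \<le> B \<zeta>"
    by metis
  have "cball (0 :: complex) r \<subseteq> (\<Union>\<zeta>\<in>cball 0 r. ball \<zeta> (d \<zeta>))"
    using d by force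
  then obtain C where C: "C \<subseteq> cball 0 r" "finite C" "cball (0 :: complex) r \<subseteq> (\<Union>\<zeta>\<in>C. ball \<zeta> (d \<zeta>))"
    using compactE_image[OF compact_cball, of "cball 0 r" "\<lambda>\<zeta>. ball \<zeta> (d \<zeta>)" 0 r] by auto
  show ?thesis
  proof (rule that[of "1 + (\<Sum>\<zeta>\<in>C. \<bar>B \<zeta>\<bar>)"])
    show "0 < 1 + (\<Sum>\<zeta>\<in>C. \<bar>B \<zeta>\<bar>)"
      by (intro add_pos_nonneg sum_nonneg) auto
    fix y :: complex assume y: "y \<in> ball 0 r"
    then obtain \<zeta> where \<zeta>: "\<zeta> \<in> C" "y \<in> ball \<zeta> (d \<zeta>)" using C(3) by force
    have "norm (g y) \<le> B \<zeta>" using B[of \<zeta> y] \<zeta> y C(1) by auto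
    also have "\<dots> \<le> \<bar>B \<zeta>\<bar>" by simp
    also have "\<dots> \<le> (\<Sum>\<zeta>\<in>C. \<bar>B \<zeta>\<bar>)"
      by (rule member_le_sum) (use \<zeta> C in auto)
    finally show "norm (g y) \<le> 1 + (\<Sum>\<zeta>\<in>C. \<bar>B \<zeta>\<bar>)" by simp
  qed
qed

text \<open>Since \<open>g\<close> may not extend to the circle, the inequality is taken on the
  radii \<open>s < r\<close>, with the same \<open>B\<close>, and \<open>s\<close> tends to
  \<open>r\<close>.\<close>

lemma Cauchy_inequality_open_ball:
  assumes g: "g holomorphic_on ball 0 r" and r: "r > 0"
    and B: "\<And>y. y \<in> ball 0 r \<Longrightarrow> norm (g y) \<le> B"
  shows "norm ((deriv ^^ n) g 0) * r ^ n \<le> fact n * B"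
proof (rule tendsto_upperbound)
  show "((\<lambda>s. norm ((deriv ^^ n) g 0) * s ^ n) \<longlongrightarrow> norm ((deriv ^^ n) g 0) * r ^ n) (at_left r)"
    by (intro tendsto_intros)
  have "\<forall>\<^sub>F s in at_left r. s \<in> {0<..<r}"
    using r by (rule eventually_at_left_real)
  thus "\<forall>\<^sub>F s in at_left r. norm ((deriv ^^ n) g 0) * s ^ n \<le> fact n * B"
  proof eventually_elim
    case (elim s)
    have "norm ((deriv ^^ n) g 0) \<le> fact n * B / s ^ n"
    proof (rule Cauchy_inequality)
      show "g holomorphic_on ball 0 s" "continuous_on (cball 0 s) g" "0 < s"
        using elim by (auto intro: holomorphic_on_subset[OF g]
            intro!: holomorphic_on_imp_continuous_on)
      show "norm (g x) \<le> B" if "norm (0 - x) = s" for x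
        using that elim by (intro B) auto
    qed
    thus ?case using elim by (simp add: field_simps)
  qed
qed auto

text \<open>The \<open>K\<close>-th derivative is bounded, and differentiation multiplies the
  coefficient by \<open>(n + K)! / n!\<close>, which is at least \<open>(n + 1)^K\<close>. This
  factor is the gain from cancelling \<open>K\<close> odd coefficients.\<close>

lemma darboux_coeff_bound:
  assumes f: "f holomorphic_on ball 0 r" "r > 0" "f has_fps_expansion F"
    and P: "\<And>\<zeta>. norm \<zeta> = r \<Longrightarrow>
      \<exists>P. sqrt_expansion f \<zeta> P \<and> (\<forall>j<K. P $ (2 * j + 1) = 0)"
  obtains B where "B > 0"
    "\<And>n. norm (F $ (n + K)) * (real n + 1) ^ K \<le> B / r ^ n"
proof -
  define g where "g = (deriv ^^ K) f"
  have g: "g holomorphic_on ball 0 r"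
    unfolding g_def using f by (intro holomorphic_higher_deriv) auto
  have "\<exists>d>0. \<exists>B. \<forall>y\<in>ball \<zeta> d \<inter> ball 0 r. norm (g y) \<le> B" if \<zeta>: "norm \<zeta> = r" for \<zeta>
  proof -
    have \<zeta>0: "\<zeta> \<noteq> 0" using f \<zeta> by auto
    obtain Q where "sqrt_expansion g \<zeta> Q"
      using P[OF \<zeta>] sqrt_expansion_higher_deriv[OF \<zeta>0] unfolding g_def by metis
    thus "\<exists>d>0. \<exists>B. \<forall>y\<in>ball \<zeta> d \<inter> ball 0 r. norm (g y) \<le> B"
      using sqrt_expansion_imp_bounded[OF \<zeta>0] \<zeta> by metis
  qed
  then obtain B where B: "B > 0" "\<And>y. y \<in> ball 0 r \<Longrightarrow> norm (g y) \<le> B"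
    using bounded_on_ball_if_locally_bounded[OF holomorphic_on_imp_continuous_on[OF g]] by blast
  have "norm (F $ (n + K)) * (real n + 1) ^ K \<le> B / r ^ n" for n
  proof -
    have "F $ (n + K) = (deriv ^^ (n + K)) f 0 / fact (n + K)"
      using f(3) by (rule fps_nth_fps_expansion)
    hence "(deriv ^^ n) g 0 = fact (n + K) * F $ (n + K)"
      by (simp add: g_def funpow_add)
    hence "fact (n + K) * (norm (F $ (n + K)) * r ^ n) \<le> fact n * B"
      using Cauchy_inequality_open_ball[OF g f(2) B(2), of n] by (simp add: norm_mult mult.assoc)
    moreover have "fact n * (real n + 1) ^ K \<le> fact (n + K)"
    proof (induction K)
      case (Suc K)
      have "fact n * (real n + 1) ^ Suc K = (real n + 1) * (fact n * (real n + 1) ^ K)" by simp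
      also have "\<dots> \<le> (real n + 1 + real K) * fact (n + K)"
        by (intro mult_mono Suc.IH) auto
      finally show ?case by (simp add: algebra_simps)
    qed simp
    hence "fact n * (real n + 1) ^ K * (norm (F $ (n + K)) * r ^ n)
        \<le> fact (n + K) * (norm (F $ (n + K)) * r ^ n)"
      using f(2) by (intro mult_right_mono) auto
    ultimately have "fact n * (real n + 1) ^ K * (norm (F $ (n + K)) * r ^ n) \<le> fact n * B"
      by (rule order.trans[rotated])
    hence "(real n + 1) ^ K * (norm (F $ (n + K)) * r ^ n) \<le> B"
      by (simp only: mult.assoc mult_le_cancel_left_pos fact_gt_zero)
    thus ?thesis using f(2) by (simp add: field_simps)
  qed
  thus ?thesis using B(1) that by blast
qed

subsection \<open>Comparison functions\<close>

lemma odd_coeff_eq_0_if_even_function: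
  fixes F :: "complex fps"
  assumes f: "f has_fps_expansion F" and even: "\<forall>\<^sub>F u in nhds 0. f (- u) = f u"
    and n: "odd n"
  shows "F $ n = 0"
proof -
  have "(\<lambda>u. - 1 * u) has_fps_expansion fps_const (- 1 :: complex) * fps_X"
    by (rule has_fps_expansion_cmult_left[OF has_fps_expansion_fps_X])
  from has_fps_expansion_compose[OF f this]
  have "(f \<circ> (\<lambda>u. - 1 * u)) has_fps_expansion (F oo (fps_const (- 1) * fps_X))"
    by simp
  moreover have "\<forall>\<^sub>F u in nhds 0. (f \<circ> (\<lambda>u. - 1 * u)) u = f u"
    using even by simp
  ultimately have "f has_fps_expansion (F oo (fps_const (- 1) * fps_X))"
    by (subst has_fps_expansion_cong[OF _ refl]) (auto simp: eq_commute elim: eventually_mono)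
  hence "F oo (fps_const (- 1) * fps_X) = F"
    using f by (rule fps_expansion_unique_complex)
  hence "(F oo (fps_const (- 1) * fps_X)) $ n = F $ n" by (rule arg_cong)
  thus ?thesis using n by (simp only: fps_compose_linear) simp
qed

text \<open>At \<open>1\<close> this function is \<open>(1 - y\<^sup>2)\<close> to the power \<open>k + 1/2\<close> plus an analytic function, and
  at \<open>- 1\<close> it is analytic. Unlike for the bare power, the odd coefficients times the
  double factorials are exact multiples of the values of Gamma in the expansion.\<close>

definition arcsin_kernel :: "nat \<Rightarrow> complex \<Rightarrow> complex" where
  "arcsin_kernel k y = csqrt (1 - y\<^sup>2) ^ (2 * k + 1) * (1 / 2 + Arcsin y / of_real pi)"

text \<open>The removed rays are the cuts of both \<open>csqrt (1 - y^2)\<close> and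
  \<open>Arcsin\<close>. They meet the unit circle only at 1 and -1.\<close>

definition double_slit_plane :: "complex set" where
  "double_slit_plane = {y. Im y = 0 \<longrightarrow> \<bar>Re y\<bar> < 1}"

lemma open_double_slit_plane: "open double_slit_plane"
proof -
  have "double_slit_plane = - {y. Im y = 0 \<and> 1 \<le> \<bar>Re y\<bar>}"
    by (auto simp: double_slit_plane_def)
  moreover have "closed {y. Im y = 0 \<and> 1 \<le> \<bar>Re y\<bar>}"
    by (intro closed_Collect_conj closed_Collect_eq closed_Collect_le continuous_intros)
  ultimately show ?thesis by (metis open_Compl)
qed

lemma ball_subset_double_slit_plane: "ball 0 1 \<subseteq> double_slit_plane"
  unfolding double_slit_plane_def by (auto intro: le_less_trans[OF abs_Re_le_cmod])

lemma arcsin_kernel_holomorphic: "arcsin_kernel k holomorphic_on double_slit_plane"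
  unfolding arcsin_kernel_def[abs_def]
  by (intro holomorphic_intros holomorphic_on_Arcsin)
     (auto simp: double_slit_plane_def one_minus_z2_notin_nonpos_Reals)

text \<open>With \<open>c\<close> the root of \<open>1 - y^2\<close>, the derivatives of
  \<open>c\<close> and \<open>Arcsin\<close> are \<open>- y / c\<close> and \<open>1 / c\<close>.
  Multiplication by \<open>c^2\<close> clears the denominators, and the arcsine survives only inside
  the kernel: the inhomogeneous term is a polynomial.\<close>

lemma arcsin_kernel_deriv:
  assumes "norm y < 1"
  shows "(1 - y\<^sup>2) * deriv (arcsin_kernel k) y =
    - of_nat (2 * k + 1) * y * arcsin_kernel k y + (1 - y\<^sup>2) ^ (k + 1) / of_real pi"
proof -
  define c where "c = csqrt (1 - y\<^sup>2)"
  have Re: "\<bar>Re y\<bar> < 1" using abs_Re_le_cmod[of y] assms by linarith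
  have nonpos: "1 - y\<^sup>2 \<notin> \<real>\<^sub>\<le>\<^sub>0" using Re by (intro one_minus_z2_notin_nonpos_Reals)
  hence c0: "c \<noteq> 0" by (auto simp: c_def)
  have c2: "c\<^sup>2 = 1 - y\<^sup>2" by (simp add: c_def)
  \<comment> \<open>The cosine of \<open>Arcsin y\<close> is one of the two roots of
    \<open>1 - y^2\<close>; this sign identifies it as the principal one.\<close>
  have "0 < cos (Re (Arcsin y))" using Arcsin_bounds[OF Re] by (intro cos_gt_zero_pi) auto
  hence cos: "cos (Arcsin y) = c" by (subst cos_sin_csqrt) (auto simp: c_def)
  have "((\<lambda>y. csqrt (1 - y\<^sup>2)) has_field_derivative - y / c) (at y)"
    using nonpos by (auto intro!: derivative_eq_intros simp: c_def field_simps)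
  hence pow: "((\<lambda>y. csqrt (1 - y\<^sup>2) ^ (2 * k + 1)) has_field_derivative
      of_nat (2 * k + 1) * (- y / c * c ^ (2 * k))) (at y)"
    using DERIV_power[of "\<lambda>y. csqrt (1 - y\<^sup>2)" "- y / c" y UNIV "2 * k + 1"] by (simp add: c_def)
  have arc: "((\<lambda>y. 1 / 2 + Arcsin y / of_real pi) has_field_derivative 1 / (c * of_real pi)) (at y)"
    using Re by (auto intro!: derivative_eq_intros simp: cos field_simps)
  have "deriv (arcsin_kernel k) y =
      of_nat (2 * k + 1) * (- y / c * c ^ (2 * k)) * (1 / 2 + Arcsin y / of_real pi)
      + 1 / (c * of_real pi) * c ^ (2 * k + 1)"
    using DERIV_mult[OF pow arc] unfolding arcsin_kernel_def[abs_def]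
    by (intro DERIV_imp_deriv) (simp add: c_def)
  moreover have "c\<^sup>2 * (of_nat (2 * k + 1) * (- y / c * c ^ (2 * k)) * E
      + 1 / (c * of_real pi) * c ^ (2 * k + 1)) =
      - of_nat (2 * k + 1) * y * (c ^ (2 * k + 1) * E) + (c\<^sup>2) ^ (k + 1) / of_real pi" for E
  proof -
    have "c\<^sup>2 * (- y / c * c ^ (2 * k)) = - y * c ^ (2 * k + 1)"
      using c0 by (simp add: power2_eq_square)
    moreover have "c\<^sup>2 * (1 / (c * of_real pi) * c ^ (2 * k + 1)) = (c\<^sup>2) ^ (k + 1) / of_real pi"
      using c0 by (simp add: power2_eq_square power_mult_distrib power_mult field_simps)
    moreover have "c\<^sup>2 * (of_nat (2 * k + 1) * (- y / c * c ^ (2 * k)) * E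
        + 1 / (c * of_real pi) * c ^ (2 * k + 1)) =
      of_nat (2 * k + 1) * (c\<^sup>2 * (- y / c * c ^ (2 * k))) * E
        + c\<^sup>2 * (1 / (c * of_real pi) * c ^ (2 * k + 1))"
      by (simp only: distrib_left mult_ac)
    ultimately show ?thesis by (simp only: mult_minus_left mult_minus_right mult_ac)
  qed
  ultimately have "c\<^sup>2 * deriv (arcsin_kernel k) y =
      - of_nat (2 * k + 1) * y * (c ^ (2 * k + 1) * (1 / 2 + Arcsin y / of_real pi))
      + (c\<^sup>2) ^ (k + 1) / of_real pi"
    by simp
  thus ?thesis by (simp add: c2 arcsin_kernel_def c_def)
qed

text \<open>For the polynomial in the differential equation: it feeds its leading coefficient into
  the recursion once and nothing beyond.\<close>

lemma one_minus_X2_power_nth: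
  "((1 - fps_X ^ 2) ^ n :: 'a :: comm_ring_1 fps) $ (2 * (n + m)) = (if m = 0 then (-1) ^ n else 0)"
proof (induction n arbitrary: m)
  case (Suc n)
  define Q :: "'a fps" where "Q = (1 - fps_X ^ 2) ^ n"
  have "(1 - fps_X ^ 2) ^ Suc n = Q - fps_X ^ 2 * Q"
    unfolding Q_def by (simp only: power_Suc left_diff_distrib mult_1_left)
  hence "((1 - fps_X ^ 2) ^ Suc n :: 'a fps) $ (2 * (Suc n + m)) =
      Q $ (2 * (n + Suc m)) - Q $ (2 * (n + m))"
    by (simp only: fps_sub_nth fps_X_power_mult_nth) simp
  hence "((1 - fps_X ^ 2) ^ Suc n :: 'a fps) $ (2 * (Suc n + m)) =
      ((1 - fps_X ^ 2) ^ n) $ (2 * (n + Suc m)) - ((1 - fps_X ^ 2) ^ n) $ (2 * (n + m))"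
    unfolding Q_def .
  thus ?case unfolding Suc.IH by simp
qed simp

definition arcsin_kernel_fps :: "nat \<Rightarrow> complex fps" where
  "arcsin_kernel_fps k = fps_expansion (arcsin_kernel k) 0"

lemma arcsin_kernel_has_fps_expansion: "arcsin_kernel k has_fps_expansion arcsin_kernel_fps k"
  unfolding arcsin_kernel_fps_def
  by (rule has_fps_expansion_fps_expansion[OF open_ball[of 0 1]])
     (auto intro: holomorphic_on_subset[OF arcsin_kernel_holomorphic ball_subset_double_slit_plane])

text \<open>Comparison of the coefficients of \<open>y^(2m + 2)\<close>. At \<open>m = k\<close> the
  first term on the right vanishes, so the recursion restarts there with a known value, whatever the
  earlier coefficients are.\<close>

lemma arcsin_kernel_fps_rec:
  "of_nat (2 * m + 3) * arcsin_kernel_fps k $ (2 * m + 3) =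
     2 * (of_nat m - of_nat k) * arcsin_kernel_fps k $ (2 * m + 1)
     + ((1 - fps_X ^ 2) ^ (k + 1)) $ (2 * (m + 1)) / of_real pi"
proof -
  let ?F = "arcsin_kernel_fps k"
  have F: "arcsin_kernel k has_fps_expansion ?F" by (rule arcsin_kernel_has_fps_expansion)
  have sq: "(\<lambda>y::complex. 1 - y\<^sup>2) has_fps_expansion 1 - fps_X ^ 2"
    by (intro fps_expansion_intros)
  have L: "(\<lambda>y. (1 - y\<^sup>2) * deriv (arcsin_kernel k) y) has_fps_expansion
      (1 - fps_X ^ 2) * fps_deriv ?F"
    by (intro fps_expansion_intros F sq)
  have R: "(\<lambda>y. - of_nat (2 * k + 1) * (y * arcsin_kernel k y)
        + 1 / of_real pi * (1 - y\<^sup>2) ^ (k + 1)) has_fps_expansion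
      fps_const (- of_nat (2 * k + 1)) * (fps_X * ?F)
        + fps_const (1 / of_real pi) * (1 - fps_X ^ 2) ^ (k + 1)"
    by (intro has_fps_expansion_add has_fps_expansion_cmult_left has_fps_expansion_mult
         has_fps_expansion_power has_fps_expansion_fps_X F sq)
  have "\<forall>\<^sub>F y in nhds (0 :: complex). y \<in> ball 0 1"
    by (intro eventually_nhds_in_open) auto
  hence "\<forall>\<^sub>F y in nhds 0. (1 - y\<^sup>2) * deriv (arcsin_kernel k) y =
      - of_nat (2 * k + 1) * (y * arcsin_kernel k y) + 1 / of_real pi * (1 - y\<^sup>2) ^ (k + 1)"
    by eventually_elim (use arcsin_kernel_deriv in \<open>auto simp: mult_ac\<close>)
  from has_fps_expansion_cong[OF this refl] L
  have "(\<lambda>y. - of_nat (2 * k + 1) * (y * arcsin_kernel k y)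
        + 1 / of_real pi * (1 - y\<^sup>2) ^ (k + 1)) has_fps_expansion (1 - fps_X ^ 2) * fps_deriv ?F"
    by (rule iffD1)
  from fps_expansion_unique_complex[OF this R]
  have "fps_deriv ?F - fps_X ^ 2 * fps_deriv ?F =
      fps_const (- of_nat (2 * k + 1)) * (fps_X * ?F)
        + fps_const (1 / of_real pi) * (1 - fps_X ^ 2) ^ (k + 1)"
    by (simp only: left_diff_distrib mult_1_left)
  hence "(fps_deriv ?F - fps_X ^ 2 * fps_deriv ?F) $ (2 * (m + 1)) =
      (fps_const (- of_nat (2 * k + 1)) * (fps_X * ?F)
        + fps_const (1 / of_real pi) * (1 - fps_X ^ 2) ^ (k + 1)) $ (2 * (m + 1))"
    by (rule arg_cong)
  hence "of_nat (2 * m + 3) * ?F $ (2 * m + 3) - of_nat (2 * m + 1) * ?F $ (2 * m + 1) =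
      - of_nat (2 * k + 1) * ?F $ (2 * m + 1)
        + 1 / of_real pi * ((1 - fps_X ^ 2) ^ (k + 1)) $ (2 * (m + 1))"
    by (simp only: fps_sub_nth fps_add_nth fps_X_power_mult_nth fps_mult_left_const_nth
          fps_deriv_nth) (simp add: eval_nat_numeral del: power_Suc)
  hence "of_nat (2 * m + 3) * ?F $ (2 * m + 3) =
      (of_nat (2 * m + 1) - of_nat (2 * k + 1)) * ?F $ (2 * m + 1)
        + 1 / of_real pi * ((1 - fps_X ^ 2) ^ (k + 1)) $ (2 * (m + 1))"
  proof -
    have "A - b * x = - c * x + Z \<Longrightarrow> A = (b - c) * x + Z" for A b c x Z :: complex
      by (simp add: algebra_simps)
    with \<open>_ = - of_nat (2 * k + 1) * _ + _\<close> show ?thesis by blast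
  qed
  also have "of_nat (2 * m + 1) - of_nat (2 * k + 1) = 2 * (of_nat m - of_nat k :: complex)"
    by simp
  finally show ?thesis by simp
qed

text \<open>With \<open>n = k + 1 + l\<close> the double factorial on the left is
  \<open>(2n + 1)!!\<close> and \<open>fact l\<close> is \<open>Gamma (n - k)\<close>. The restart
  of the recursion gives \<open>l = 0\<close>; after it each step only multiplies by
  \<open>2 (l + 1)\<close>.\<close>

lemma arcsin_kernel_fps_nth:
  "of_nat (odd_double_fact (k + l + 2)) * arcsin_kernel_fps k $ (2 * (k + 1 + l) + 1) =
     (- 1) ^ (k + 1) * of_nat (odd_double_fact (k + 1)) * 2 ^ l * fact l / of_real pi"
  unfolding odd_double_fact_def
proof (induction l)
  case 0
  have "((1 - fps_X ^ 2) ^ (k + 1) :: complex fps) $ (2 * (k + 1)) = (- 1) ^ (k + 1)"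
    using one_minus_X2_power_nth[of "k + 1" 0, where 'a = complex] by simp
  hence "of_nat (2 * k + 3) * arcsin_kernel_fps k $ (2 * k + 3) = (- 1) ^ (k + 1) / of_real pi"
    using arcsin_kernel_fps_rec[of k k] by simp
  hence "of_nat (\<Prod>j<k + 1. 2 * j + 1) * (of_nat (2 * k + 3) * arcsin_kernel_fps k $ (2 * k + 3)) =
      of_nat (\<Prod>j<k + 1. 2 * j + 1) * ((- 1) ^ (k + 1) / of_real pi)" by (rule arg_cong)
  moreover have "(\<Prod>j<k + 0 + 2. 2 * j + 1) = (\<Prod>j<k + 1. 2 * j + 1) * (2 * k + 3)"
    by (simp add: algebra_simps)
  moreover have "2 * (k + 1 + 0) + 1 = 2 * k + 3" by simp
  ultimately show ?case by (simp only: of_nat_mult mult.assoc) (simp add: mult_ac)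
next
  case (Suc l)
  let ?m = "k + 1 + l"
  have "((1 - fps_X ^ 2) ^ (k + 1) :: complex fps) $ (2 * (?m + 1)) = 0"
    using one_minus_X2_power_nth[of "k + 1" "Suc l", where 'a = complex]
    by (simp add: algebra_simps)
  hence "of_nat (2 * ?m + 3) * arcsin_kernel_fps k $ (2 * ?m + 3) =
      2 * of_nat (Suc l) * arcsin_kernel_fps k $ (2 * ?m + 1)"
    using arcsin_kernel_fps_rec[of ?m k] by (simp add: algebra_simps)
  hence "of_nat (\<Prod>j<k + l + 2. 2 * j + 1) *
      (of_nat (2 * ?m + 3) * arcsin_kernel_fps k $ (2 * ?m + 3)) =
      2 * of_nat (Suc l) *
      (of_nat (\<Prod>j<k + l + 2. 2 * j + 1) * arcsin_kernel_fps k $ (2 * ?m + 1))"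
    by (simp only: mult_ac)
  hence *: "of_nat (\<Prod>j<k + l + 2. 2 * j + 1) *
      (of_nat (2 * ?m + 3) * arcsin_kernel_fps k $ (2 * ?m + 3)) =
      2 * of_nat (Suc l) *
      ((- 1) ^ (k + 1) * of_nat (\<Prod>j<k + 1. 2 * j + 1) * 2 ^ l * fact l / of_real pi)"
    unfolding Suc.IH .
  have "(\<Prod>j<k + Suc l + 2. 2 * j + 1) = (\<Prod>j<k + l + 2. 2 * j + 1) * (2 * ?m + 3)"
    by (simp add: algebra_simps)
  moreover have "2 * (k + 1 + Suc l) + 1 = 2 * ?m + 3" by simp
  ultimately show ?case using * by (simp only: of_nat_mult mult.assoc) (simp add: mult_ac)
qed

text \<open>With \<open>u\<close> the square root of \<open>1 - y\<close>, this is the square root of \<open>1 - y\<^sup>2\<close> as a series in \<open>u\<close>.\<close>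

definition sqrt_kernel_fps :: "complex fps" where
  "sqrt_kernel_fps = fps_X * fps_expansion (\<lambda>u. csqrt (2 - u\<^sup>2)) 0"

lemma csqrt_two_minus_square_holomorphic: "(\<lambda>u. csqrt (2 - u\<^sup>2)) holomorphic_on ball 0 1"
proof (intro holomorphic_intros)
  fix u :: complex assume "u \<in> ball 0 1"
  hence "norm (u\<^sup>2) < 1" by (simp add: norm_power power_less_one_iff)
  hence "Re (u\<^sup>2) < 1" using complex_Re_le_cmod[of "u\<^sup>2"] by linarith
  thus "2 - u\<^sup>2 \<notin> \<real>\<^sub>\<le>\<^sub>0" by (auto simp: complex_nonpos_Reals_iff)
qed

lemma csqrt_two_minus_square_has_fps_expansion:
  "(\<lambda>u. csqrt (2 - u\<^sup>2)) has_fps_expansion fps_expansion (\<lambda>u. csqrt (2 - u\<^sup>2)) 0"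
  by (rule has_fps_expansion_fps_expansion[OF open_ball[of 0 1]])
     (use csqrt_two_minus_square_holomorphic in auto)

lemma sqrt_kernel_has_fps_expansion:
  "(\<lambda>u. u * csqrt (2 - u\<^sup>2)) has_fps_expansion sqrt_kernel_fps"
  unfolding sqrt_kernel_fps_def
  by (intro has_fps_expansion_mult has_fps_expansion_fps_X csqrt_two_minus_square_has_fps_expansion)

lemma sqrt_kernel_fps_0 [simp]: "sqrt_kernel_fps $ 0 = 0"
  by (simp add: sqrt_kernel_fps_def)

lemma sqrt_kernel_fps_1: "sqrt_kernel_fps $ 1 = of_real (sqrt 2)"
proof -
  have "fps_expansion (\<lambda>u. csqrt (2 - u\<^sup>2)) 0 $ 0 = csqrt 2"
    by (simp add: fps_expansion_def)
  thus ?thesis using csqrt_of_real[of 2] by (simp add: sqrt_kernel_fps_def)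
qed

text \<open>This is \<open>1 - y^2\<close> for \<open>y = 1 - u^2\<close>; identities about the root
  become polynomial ones after squaring.\<close>

lemma sqrt_kernel_fps_square: "sqrt_kernel_fps ^ 2 = 2 * fps_X ^ 2 - fps_X ^ 4"
proof (rule fps_expansion_unique_complex)
  show "(\<lambda>u. (u * csqrt (2 - u\<^sup>2)) ^ 2) has_fps_expansion sqrt_kernel_fps ^ 2"
    by (intro has_fps_expansion_power sqrt_kernel_has_fps_expansion)
  have "(\<lambda>u::complex. 2 * u ^ 2 - u ^ 4) has_fps_expansion 2 * fps_X ^ 2 - fps_X ^ 4"
    by (intro fps_expansion_intros)
  moreover have "(\<lambda>u. (u * csqrt (2 - u\<^sup>2)) ^ 2) = (\<lambda>u::complex. 2 * u ^ 2 - u ^ 4)"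
    by (rule ext, simp only: power_mult_distrib power2_csqrt)
       (simp add: algebra_simps flip: power_add)
  ultimately show "(\<lambda>u. (u * csqrt (2 - u\<^sup>2)) ^ 2) has_fps_expansion 2 * fps_X ^ 2 - fps_X ^ 4"
    by simp
qed

section \<open>Local behaviour of the comparison functions on the circle\<close>

text \<open>From the half-angle formula: if \<open>sin v = u / sqrt 2\<close> with
  \<open>u^2 = 1 - y\<close>, then \<open>y = cos (2 v)\<close>, so
  \<open>1/2 + arcsin y / \<pi>\<close> equals \<open>1 - 2 v / \<pi>\<close>.\<close>

definition arcsin_correction :: "complex \<Rightarrow> complex" where
  "arcsin_correction u = 2 / of_real pi * Arcsin (u / of_real (sqrt 2))"

lemma arcsin_kernel_at_1:
  assumes y: "norm y < 1"
  defines "u \<equiv> csqrt (1 - y)"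
  shows "arcsin_kernel k y = (u * csqrt (2 - u\<^sup>2)) ^ (2 * k + 1) * (1 - arcsin_correction u)"
    and "arcsin_kernel k (- y) = (u * csqrt (2 - u\<^sup>2)) ^ (2 * k + 1) * arcsin_correction u"
proof -
  have Rey: "\<bar>Re y\<bar> < 1" using abs_Re_le_cmod[of y] y by linarith
  have u2: "u\<^sup>2 = 1 - y" by (simp add: u_def)
  \<comment> \<open>Both factors lie in the right half-plane, so their arguments add without leaving
    the principal range and \<open>csqrt\<close> is multiplicative.\<close>
  have "\<bar>Arg (1 - y)\<bar> < pi / 2" "\<bar>Arg (1 + y)\<bar> < pi / 2"
    unfolding Arg_Re_pos using Rey by auto
  hence "csqrt ((1 - y) * (1 + y)) = csqrt (1 - y) * csqrt (1 + y)"
    by (intro csqrt_mult) (auto simp: abs_if split: if_splits)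
  hence root: "csqrt (1 - y\<^sup>2) = u * csqrt (2 - u\<^sup>2)"
  proof -
    have "(1 - y) * (1 + y) = 1 - y\<^sup>2" "1 + y = 2 - u\<^sup>2"
      unfolding u2 by (simp_all add: algebra_simps power2_eq_square)
    with \<open>csqrt ((1 - y) * (1 + y)) = _\<close> show ?thesis by (simp only: u_def)
  qed
  define v where "v = Arcsin (u / of_real (sqrt 2))"
  have sin_v: "sin v = u / of_real (sqrt 2)" by (simp add: v_def)
  have "Re u \<noteq> 0"
  proof
    assume "Re u = 0"
    hence "Re (u\<^sup>2) \<le> 0" by (simp add: Re_power2)
    thus False using Rey by (simp add: u2)
  qed
  hence Re_u: "Re u > 0" using Re_csqrt[of "1 - y"] by (simp add: u_def)
  have "norm (1 - y) < 2" using norm_triangle_ineq4[of 1 y] y by simp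
  hence "norm u < sqrt 2" by (simp add: u_def)
  hence "\<bar>Re (u / of_real (sqrt 2))\<bar> < 1"
    using abs_Re_le_cmod[of u] by (simp add: Re_divide_of_real)
  hence bd: "\<bar>Re v\<bar> < pi / 2" unfolding v_def by (rule Arcsin_bounds)
  \<comment> \<open>\<open>Re (sin v)\<close> has the sign of \<open>sin (Re v)\<close>. Together
    with \<open>bd\<close> this puts \<open>\<pi>/2 - 2 v\<close> into the strip on which
    \<open>Arcsin\<close> inverts the sine.\<close>
  have "Re (sin v) > 0" using Re_u by (simp add: sin_v Re_divide_of_real)
  hence "sin (Re v) > 0"
    unfolding Re_sin using add_pos_pos[OF exp_gt_zero exp_gt_zero, of "Im v" "- Im v"]
    by (auto simp: zero_less_mult_iff)
  hence pos: "Re v > 0"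
    using bd sin_ge_zero[of "- Re v"] by (cases "Re v > 0") auto
  have "sin (of_real pi / 2 - 2 * v) = 1 - 2 * (sin v)\<^sup>2"
    by (simp add: sin_diff cos_double_sin sin_of_real cos_of_real flip: of_real_divide)
  also have "\<dots> = y"
    by (simp add: sin_v power_divide u2 field_simps flip: of_real_power)
  finally have sin_eq: "sin (of_real pi / 2 - 2 * v) = y" .
  hence arc: "Arcsin y = of_real pi / 2 - 2 * v"
    by (rule Arcsin_unique) (use bd pos in \<open>auto simp: abs_if split: if_splits\<close>)
  have "sin (- (of_real pi / 2 - 2 * v)) = - y"
    by (simp only: sin_minus sin_eq)
  hence arc': "Arcsin (- y) = - (of_real pi / 2 - 2 * v)"
    by (rule Arcsin_unique) (use bd pos in \<open>auto simp: abs_if split: if_splits\<close>)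
  show "arcsin_kernel k y = (u * csqrt (2 - u\<^sup>2)) ^ (2 * k + 1) * (1 - arcsin_correction u)"
    unfolding arcsin_kernel_def root arc arcsin_correction_def v_def[symmetric]
    by (simp add: field_simps)
  show "arcsin_kernel k (- y) = (u * csqrt (2 - u\<^sup>2)) ^ (2 * k + 1) * arcsin_correction u"
    unfolding arcsin_kernel_def power2_minus root arc' arcsin_correction_def v_def[symmetric]
    by (simp add: field_simps)
qed

lemma arcsin_correction_minus:
  assumes "norm u < 1"
  shows "arcsin_correction (- u) = - arcsin_correction u"
proof -
  have "norm (u / of_real (sqrt 2)) < 1"
    using assms by (simp add: norm_divide) (smt (verit) real_sqrt_ge_one)
  hence "\<bar>Re (Arcsin (u / of_real (sqrt 2)))\<bar> < pi / 2"
    by (intro Arcsin_bounds) (use abs_Re_le_cmod le_less_trans in blast)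
  hence "Arcsin (- (u / of_real (sqrt 2))) = - Arcsin (u / of_real (sqrt 2))"
    by (intro Arcsin_unique) auto
  thus ?thesis by (simp add: arcsin_correction_def)
qed


lemma arcsin_correction_holomorphic: "arcsin_correction holomorphic_on ball 0 1"
proof -
  have "Arcsin holomorphic_on ball 0 1"
    by (rule holomorphic_on_Arcsin) (auto intro: le_less_trans[OF abs_Re_le_cmod])
  moreover have "(\<lambda>u. u / complex_of_real (sqrt 2)) ` ball 0 1 \<subseteq> ball 0 1"
    by (auto simp: norm_divide divide_simps) (smt (verit) real_sqrt_ge_one)
  ultimately have "(Arcsin \<circ> (\<lambda>u. u / complex_of_real (sqrt 2))) holomorphic_on ball 0 1"
    by (intro holomorphic_on_compose_gen[where t = "ball 0 1"] holomorphic_intros) auto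
  thus ?thesis unfolding arcsin_correction_def[abs_def]
    by (intro holomorphic_intros) (simp add: o_def)
qed

text \<open>A parity argument: the correction is odd in \<open>u\<close>, and so is an odd power of
  the root kernel, so their product \<open>E\<close> is even. It is all that remains at
  \<open>- \<rho>\<close>, and at \<open>\<rho>\<close> it does not touch the odd
  coefficients.\<close>

lemma arcsin_kernel_sqrt_expansion:
  assumes \<rho>: "\<rho> \<noteq> 0"
  obtains E where
    "sqrt_expansion (\<lambda>y. arcsin_kernel k (y / \<rho>)) \<rho> (sqrt_kernel_fps ^ (2 * k + 1) - E)"
    "sqrt_expansion (\<lambda>y. arcsin_kernel k (y / \<rho>)) (- \<rho>) E"
    "\<And>n. odd n \<Longrightarrow> E $ n = 0"
proof -
  let ?b = "\<lambda>u :: complex. (u * csqrt (2 - u\<^sup>2)) ^ (2 * k + 1)"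
  define E where "E = sqrt_kernel_fps ^ (2 * k + 1) * fps_expansion arcsin_correction 0"
  have b: "?b has_fps_expansion sqrt_kernel_fps ^ (2 * k + 1)"
    by (intro has_fps_expansion_power sqrt_kernel_has_fps_expansion)
  have corr: "arcsin_correction has_fps_expansion fps_expansion arcsin_correction 0"
    by (rule has_fps_expansion_fps_expansion[OF open_ball[of 0 1]])
       (use arcsin_correction_holomorphic in auto)
  have E: "(\<lambda>u. ?b u * arcsin_correction u) has_fps_expansion E"
    unfolding E_def by (intro has_fps_expansion_mult b corr)
  show ?thesis
  proof (rule that[of E])
    show "E $ n = 0" if "odd n" for n
    proof (rule odd_coeff_eq_0_if_even_function[OF E _ that])
      have "\<forall>\<^sub>F u in nhds (0 :: complex). u \<in> ball 0 1"
        by (intro eventually_nhds_in_open) auto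
      thus "\<forall>\<^sub>F u in nhds 0. ?b (- u) * arcsin_correction (- u) = ?b u * arcsin_correction u"
        by eventually_elim (simp add: arcsin_correction_minus)
    qed
    have ev: "\<forall>\<^sub>F y in at \<zeta> within ball 0 (norm \<rho>). norm (y / \<rho>) < 1" for \<zeta>
      using \<rho> unfolding eventually_at by (intro exI[of _ 1]) (auto simp: norm_divide)
    have "(\<lambda>u. ?b u - ?b u * arcsin_correction u) has_fps_expansion
        sqrt_kernel_fps ^ (2 * k + 1) - E"
      by (intro has_fps_expansion_diff b E)
    moreover have "\<forall>\<^sub>F y in at \<rho> within ball 0 (norm \<rho>). arcsin_kernel k (y / \<rho>) =
        (\<lambda>u. ?b u - ?b u * arcsin_correction u) (csqrt (1 - y / \<rho>))"
      using ev by eventually_elim (simp add: arcsin_kernel_at_1(1) algebra_simps)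
    ultimately show "sqrt_expansion (\<lambda>y. arcsin_kernel k (y / \<rho>)) \<rho>
        (sqrt_kernel_fps ^ (2 * k + 1) - E)"
      by (rule sqrt_expansionI)
    show "sqrt_expansion (\<lambda>y. arcsin_kernel k (y / \<rho>)) (- \<rho>) E"
    proof (rule sqrt_expansionI[OF E], unfold norm_minus_cancel)
      show "\<forall>\<^sub>F y in at (- \<rho>) within ball 0 (norm \<rho>). arcsin_kernel k (y / \<rho>) =
        ?b (csqrt (1 - y / - \<rho>)) * arcsin_correction (csqrt (1 - y / - \<rho>))"
        using ev
      proof eventually_elim
        case (elim y)
        thus ?case using arcsin_kernel_at_1(2)[of "- (y / \<rho>)" k] by simp
      qed
    qed
  qed
qed

lemma arcsin_kernel_sqrt_expansion_regular:
  assumes "norm \<zeta> = norm \<rho>" "\<rho> \<noteq> 0" "\<zeta> \<noteq> \<rho>" "\<zeta> \<noteq> - \<rho>"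
  obtains P where "sqrt_expansion (\<lambda>y. arcsin_kernel k (y / \<rho>)) \<zeta> P" "\<And>n. odd n \<Longrightarrow> P $ n = 0"
proof -
  define U where "U = (\<lambda>y. y / \<rho>) -` double_slit_plane"
  have "open U" unfolding U_def
    by (intro open_vimage open_double_slit_plane continuous_intros) (use assms in auto)
  moreover have "\<zeta> \<in> U"
  proof -
    define z where "z = \<zeta> / \<rho>"
    have z: "norm z = 1" using assms by (simp add: z_def norm_divide)
    have "Im z \<noteq> 0"
    proof
      assume "Im z = 0"
      hence "z = of_real (Re z)" by (simp add: complex_eq_iff)
      hence "\<bar>Re z\<bar> = 1" using z by (metis norm_of_real)
      hence "z = 1 \<or> z = - 1" using \<open>z = of_real (Re z)\<close>
        by (metis abs_1 abs_eq_iff of_real_1 of_real_minus)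
      thus False using assms by (auto simp: z_def field_simps)
    qed
    thus ?thesis by (simp add: U_def double_slit_plane_def z_def)
  qed
  ultimately obtain e where e: "e > 0" "ball \<zeta> e \<subseteq> U" by (meson openE)
  have "(arcsin_kernel k \<circ> (\<lambda>y. y / \<rho>)) holomorphic_on ball \<zeta> e"
    using e assms
    by (intro holomorphic_on_compose_gen[OF _ arcsin_kernel_holomorphic] holomorphic_intros)
       (auto simp: U_def)
  hence "(\<lambda>y. arcsin_kernel k (y / \<rho>)) holomorphic_on ball \<zeta> e" by (simp add: o_def)
  moreover have "\<zeta> \<noteq> 0" using assms by auto
  ultimately show ?thesis
    using sqrt_expansion_holomorphic[of \<zeta> e "\<lambda>y. arcsin_kernel k (y / \<rho>)"] e(1) that by metis
qed

subsection \<open>Analytic continuation to the branch points\<close>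

lemma complex_fps_nth [simp]: "complex_fps F $ n = of_real (F $ n)"
  by (simp add: complex_fps_def)

lemma complex_fps_mult: "complex_fps (F * G) = complex_fps F * complex_fps G"
  by (simp add: fps_eq_iff fps_mult_nth)

lemma complex_fps_power: "complex_fps (F ^ n) = complex_fps F ^ n"
proof (induction n)
  case (Suc n)
  thus ?case by (simp add: complex_fps_mult)
qed (simp add: fps_eq_iff)

lemma isCont_tendsto_nhds: "isCont f x \<Longrightarrow> (f \<longlongrightarrow> f x) (nhds x)"
  by (simp add: isCont_def tendsto_at_iff_tendsto_nhds)

lemma complex_fps_compose: "complex_fps (F oo G) = complex_fps F oo complex_fps G"
  by (simp add: fps_eq_iff fps_compose_nth flip: complex_fps_power)

lemma eval_fps_eventually_eq_compose:
  fixes S F :: "complex fps"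
  assumes "0 < fps_conv_radius S" "0 < fps_conv_radius F" "F $ 0 = 0" and p: "p has_fps_expansion (S oo F)"
  shows "\<forall>\<^sub>F y in nhds 0. eval_fps S (eval_fps F y) = p y"
proof -
  have "(eval_fps S \<circ> eval_fps F) has_fps_expansion (S oo F)"
    using assms by (intro has_fps_expansion_compose eval_fps_has_fps_expansion)
  from has_fps_expansion_diff[OF this p]
  have "\<forall>\<^sub>F y in nhds 0. (eval_fps S \<circ> eval_fps F) y - p y = 0"
    by (simp add: has_fps_expansion_0_iff)
  thus ?thesis by eventually_elim simp
qed

text \<open>Validity of the equation near the point with parameter \<open>s\<close> is a locally
  constant property of \<open>s\<close>, hence constant on the connected interval. The end point is
  left out because \<open>f\<close> is holomorphic only on the open disc.\<close>

lemma functional_equation_along_segment: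
  fixes E :: "real \<Rightarrow> complex fps" and g :: "real \<Rightarrow> complex"
  assumes f: "f holomorphic_on ball 0 r" and \<rho>: "norm \<rho> = r" "r > 0"
    and q: "q holomorphic_on ball 0 r"
    and g: "\<And>t. 0 \<le> t \<Longrightarrow> t < 1 \<Longrightarrow> g t = f (of_real t * \<rho>)"
    and E: "\<And>t. 0 \<le> t \<Longrightarrow> t < 1 \<Longrightarrow> 0 < fps_conv_radius (E t) \<and>
      (\<forall>\<^sub>F s in at t within {0..<1}. ereal (norm (g s - g t)) < fps_conv_radius (E t) \<and>
        (\<lambda>w. eval_fps (E t) (g s - g t + w)) has_fps_expansion E s)"
    and 0: "\<forall>\<^sub>F y in nhds 0. eval_fps (E 0) (f y - g 0) = q y"
    and s: "0 \<le> s" "s < 1"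
  shows "\<forall>\<^sub>F y in nhds (of_real s * \<rho>). eval_fps (E s) (f y - g s) = q y"
proof -
  define Q where "Q = (\<lambda>t. \<forall>\<^sub>F y in nhds (of_real t * \<rho>). eval_fps (E t) (f y - g t) = q y)"
  have "Q 0 = Q s"
  proof (rule connected_local_const[of "{0..<1::real}"])
    show "\<forall>t\<in>{0..<1}. \<forall>\<^sub>F s in at t within {0..<1}. Q t = Q s"
    proof
      fix t :: real assume t: "t \<in> {0..<1}"
      have in_ball: "of_real u * \<rho> \<in> ball 0 r" if "u \<in> {0..<1}" for u :: real
        using that \<rho> by (simp add: norm_mult)
      have contf: "isCont f y" if "y \<in> ball 0 r" for y
        using holomorphic_on_imp_continuous_on[OF f] that
        by (simp add: continuous_on_eq_continuous_at)
      have "0 < fps_conv_radius (E t)" using E t by auto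
      hence "open (eball 0 (fps_conv_radius (E t)))" "0 \<in> eball 0 (fps_conv_radius (E t))"
        by (auto simp: zero_ereal_def)
      moreover have "((\<lambda>y. f y - g t) \<longlongrightarrow> 0) (nhds (of_real t * \<rho>))"
        using tendsto_diff[OF isCont_tendsto_nhds[OF contf[OF in_ball[OF t]]] tendsto_const, of "g t"] t
        by (simp add: g)
      ultimately have "\<forall>\<^sub>F y in nhds (of_real t * \<rho>). f y - g t \<in> eball 0 (fps_conv_radius (E t))"
        using topological_tendstoD by blast
      moreover have "\<forall>\<^sub>F y in nhds (of_real t * \<rho>). y \<in> ball 0 r"
        using in_ball[OF t] by (intro eventually_nhds_in_open) auto
      ultimately have "\<forall>\<^sub>F y in nhds (of_real t * \<rho>).
          f y - g t \<in> eball 0 (fps_conv_radius (E t)) \<and> y \<in> ball 0 r"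
        by eventually_elim simp
      then obtain d where d: "d > 0" "\<And>y. y \<in> ball (of_real t * \<rho>) d \<Longrightarrow>
          f y - g t \<in> eball 0 (fps_conv_radius (E t)) \<and> y \<in> ball 0 r"
        unfolding eventually_nhds_metric by (auto simp: dist_commute)
      let ?B = "ball (of_real t * \<rho>) d" and ?\<Phi> = "\<lambda>y. eval_fps (E t) (f y - g t)"
      have "(eval_fps (E t) \<circ> (\<lambda>y. f y - g t)) holomorphic_on ?B"
        using d(2)
        by (intro holomorphic_on_compose_gen[OF _ holomorphic_on_eval_fps]
              holomorphic_intros holomorphic_on_subset[OF f]) auto
      hence \<Phi>: "?\<Phi> holomorphic_on ?B" by (simp add: o_def)
      have qB: "q holomorphic_on ?B" using d(2) by (intro holomorphic_on_subset[OF q]) auto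
      \<comment> \<open>The identity theorem on one ball: the equation near any of its points is
        equivalent to the equation on all of it, and this links \<open>Q t\<close> with
        \<open>Q s\<close> in both directions.\<close>
      have spread: "?\<Phi> z = q z"
        if "\<forall>\<^sub>F y in nhds y0. ?\<Phi> y = q y" "y0 \<in> ?B" "z \<in> ?B" for y0 z
      proof -
        have "\<forall>\<^sub>F y in nhds y0. ?\<Phi> y = q y \<and> y \<in> ?B"
          using that eventually_nhds_in_open[of ?B y0] by (intro eventually_conj) auto
        then obtain N where N: "open N" "y0 \<in> N" "\<And>y. y \<in> N \<Longrightarrow> ?\<Phi> y = q y \<and> y \<in> ?B"
          unfolding eventually_nhds by blast
        show ?thesis
          by (rule analytic_continuation_open[of N ?B ?\<Phi> q])
             (use N \<Phi> qB that in \<open>auto intro: convex_connected\<close>)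
      qed
      have "\<forall>\<^sub>F s in at t within {0..<1}. of_real s * \<rho> \<in> ?B"
        by (rule topological_tendstoD) (use d in \<open>auto intro!: tendsto_intros\<close>)
      moreover have "\<forall>\<^sub>F s in at t within {0..<1}. s \<in> {0..<1}"
        by (auto simp: eventually_at_filter)
      moreover have "\<forall>\<^sub>F s in at t within {0..<1}.
          (\<lambda>w. eval_fps (E t) (g s - g t + w)) has_fps_expansion E s"
        using E[of t] t by (auto elim: eventually_mono)
      ultimately show "\<forall>\<^sub>F s in at t within {0..<1}. Q t = Q s"
      proof eventually_elim
        case (elim s)
        have "((\<lambda>y. f y - g s) \<longlongrightarrow> 0) (nhds (of_real s * \<rho>))"
          using tendsto_diff[OF isCont_tendsto_nhds[OF contf[OF in_ball[OF elim(2)]]] tendsto_const,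
              of "g s"] elim(2)
          by (simp add: g)
        moreover have "\<forall>\<^sub>F w in nhds 0. eval_fps (E s) w = eval_fps (E t) (g s - g t + w)"
          using elim(3) unfolding has_fps_expansion_def by blast
        ultimately have "\<forall>\<^sub>F y in nhds (of_real s * \<rho>).
            eval_fps (E s) (f y - g s) = eval_fps (E t) (g s - g t + (f y - g s))"
          by (rule eventually_compose_filterlim[rotated])
        hence "\<forall>\<^sub>F y in nhds (of_real s * \<rho>). eval_fps (E s) (f y - g s) = ?\<Phi> y"
          by eventually_elim simp
        hence "Q s \<longleftrightarrow> (\<forall>\<^sub>F y in nhds (of_real s * \<rho>). ?\<Phi> y = q y)"
          unfolding Q_def by (intro eventually_cong) (auto elim: eventually_mono)
        also have "\<dots> \<longleftrightarrow> (\<forall>y\<in>?B. ?\<Phi> y = q y)"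
        proof
          assume "\<forall>y\<in>?B. ?\<Phi> y = q y"
          moreover have "\<forall>\<^sub>F y in nhds (of_real s * \<rho>). y \<in> ?B"
            using elim(1) by (intro eventually_nhds_in_open) auto
          ultimately show "\<forall>\<^sub>F y in nhds (of_real s * \<rho>). ?\<Phi> y = q y"
            by (auto elim: eventually_mono)
        qed (use spread elim in blast)
        also have "\<dots> \<longleftrightarrow> Q t"
        proof
          assume "\<forall>y\<in>?B. ?\<Phi> y = q y"
          moreover have "\<forall>\<^sub>F y in nhds (of_real t * \<rho>). y \<in> ?B"
            using d by (intro eventually_nhds_in_open) auto
          ultimately show "Q t"
            unfolding Q_def by (auto elim: eventually_mono)
        qed (use spread[of "of_real t * \<rho>"] d in \<open>auto simp: Q_def\<close>)
        finally show ?case by blast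
      qed
    qed
  qed (use s in auto)
  thus ?thesis using 0 unfolding Q_def by simp
qed

text \<open>The equation is known for parameters \<open>s < 1\<close> and has to be carried to the
  end, where \<open>x(y)\<close> is singular in \<open>y\<close> but analytic in the local parameter
  \<open>u\<close>. The right-hand side is \<open>- y^2 / 2\<close> for
  \<open>y = \<rho> (1 - u^2)\<close>.\<close>

lemma continuation_at_branch_point:
  fixes S F T D :: "complex fps"
  assumes F: "F $ 0 = 0" "S oo F = - (fps_const (1 / 2) * fps_X ^ 2)"
      "fps_conv_radius F = ereal r"
    and \<rho>: "norm \<rho> = r" "r > 0"
    and D: "0 < fps_conv_radius D"
      "\<forall>\<^sub>F y in at \<rho> within ball 0 r. eval_fps F y = eval_fps D (csqrt (1 - y / \<rho>))"
    and T: "analytic_continuation_along (image_segment F \<rho> (D $ 0)) S T"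
  shows "T oo (D - fps_const (D $ 0)) = fps_const (- (\<rho>\<^sup>2 / 2)) * (1 - fps_X ^ 2) ^ 2"
proof -
  define g where "g = image_segment F \<rho> (D $ 0)"
  let ?f = "eval_fps F" and ?\<tau> = "D $ 0"
  obtain E where E01: "E 0 = S" "E 1 = T"
    and E: "\<And>t. t \<in> {0..1} \<Longrightarrow> 0 < fps_conv_radius (E t)"
      "\<And>t. t \<in> {0..1} \<Longrightarrow> \<forall>\<^sub>F s in at t within {0..1}.
             ereal (norm (g s - g t)) < fps_conv_radius (E t) \<and>
             (\<lambda>w. eval_fps (E t) (g s - g t + w)) has_fps_expansion E s"
    using T unfolding analytic_continuation_along_def g_def by blast
  have g: "g t = ?f (of_real t * \<rho>)" if "t < 1" for t
    using that by (simp add: g_def image_segment_def)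
  have f: "?f holomorphic_on ball 0 r"
    using F(3) by (intro holomorphic_on_eval_fps) auto
  have along: "\<forall>\<^sub>F y in nhds (of_real s * \<rho>). eval_fps (E s) (?f y - g s) = - (y\<^sup>2 / 2)"
    if "0 \<le> s" "s < 1" for s
  proof (rule functional_equation_along_segment[OF f \<rho>])
    show "(\<lambda>y. - (y\<^sup>2 / 2)) holomorphic_on ball 0 r" by (intro holomorphic_intros) auto
    show "g t = ?f (of_real t * \<rho>)" if "t < 1" for t using that by (rule g)
    show "0 < fps_conv_radius (E t) \<and> (\<forall>\<^sub>F s in at t within {0..<1}.
        ereal (norm (g s - g t)) < fps_conv_radius (E t) \<and>
        (\<lambda>w. eval_fps (E t) (g s - g t + w)) has_fps_expansion E s)" if "0 \<le> t" "t < 1" for t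
      using E[of t] that
      by (auto intro: filter_leD[OF at_le[of "{0..<1}" "{0..1}" t]])
    have "(\<lambda>y::complex. - (1 / 2 * y\<^sup>2)) has_fps_expansion (S oo F)"
      unfolding F(2) by (intro fps_expansion_intros)
    hence "\<forall>\<^sub>F y in nhds 0. eval_fps S (?f y) = - (1 / 2 * y\<^sup>2)"
      by (intro eval_fps_eventually_eq_compose) (use E(1)[of 0] E01 F \<rho> in auto)
    thus "\<forall>\<^sub>F y in nhds 0. eval_fps (E 0) (?f y - g 0) = - (y\<^sup>2 / 2)"
      using F(1) by (simp add: E01 g eval_fps_at_0)
  qed (use that in auto)
  define q where "q = (\<lambda>u. - (\<rho>\<^sup>2 / 2) * (1 - u\<^sup>2) ^ 2)"
  have Trad: "0 < fps_conv_radius T" using E(1)[of 1] E01 by simp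
  have "((\<lambda>u. eval_fps D u - ?\<tau>) \<longlongrightarrow> eval_fps D 0 - ?\<tau>) (nhds 0)"
    using has_fps_expansion_imp_continuous[OF eval_fps_has_fps_expansion[OF D(1)]]
    by (intro tendsto_diff tendsto_const isCont_tendsto_nhds)
  hence "((\<lambda>u. eval_fps D u - ?\<tau>) \<longlongrightarrow> 0) (nhds 0)" by (simp add: eval_fps_at_0)
  moreover have "open (eball 0 (fps_conv_radius T))" "(0::complex) \<in> eball 0 (fps_conv_radius T)"
    using Trad by (auto simp: zero_ereal_def)
  ultimately have "\<forall>\<^sub>F u in nhds 0. eval_fps D u - ?\<tau> \<in> eball 0 (fps_conv_radius T)"
    using topological_tendstoD by blast
  moreover have "\<forall>\<^sub>F u in nhds (0 :: complex). u \<in> eball 0 (fps_conv_radius D)"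
    using D(1) by (intro eventually_nhds_in_open) (auto simp: zero_ereal_def)
  ultimately have "\<forall>\<^sub>F u in nhds 0. eval_fps D u - ?\<tau> \<in> eball 0 (fps_conv_radius T)
      \<and> u \<in> eball 0 (fps_conv_radius D)" by eventually_elim simp
  then obtain e where e: "e > 0" "\<And>u. u \<in> ball 0 e \<Longrightarrow>
      eval_fps D u - ?\<tau> \<in> eball 0 (fps_conv_radius T) \<and> u \<in> eball 0 (fps_conv_radius D)"
    unfolding eventually_nhds_metric by (auto simp: dist_commute)
  have Dhol: "eval_fps D holomorphic_on ball 0 e"
    using e(2) by (intro holomorphic_on_eval_fps) auto
  have "(eval_fps T \<circ> (\<lambda>u. eval_fps D u - ?\<tau>)) holomorphic_on ball 0 e"
    using e(2)
    by (intro holomorphic_on_compose_gen[OF _ holomorphic_on_eval_fps] holomorphic_intros Dhol) auto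
  hence \<Phi>: "(\<lambda>u. eval_fps T (eval_fps D u - ?\<tau>)) holomorphic_on ball 0 e" (is "?\<Phi> holomorphic_on _")
    by (simp add: o_def)
  have q: "q holomorphic_on ball 0 e" unfolding q_def by (intro holomorphic_intros)
  obtain d where d: "d > 0" "\<And>y. y \<in> ball 0 r \<Longrightarrow> y \<noteq> \<rho> \<Longrightarrow> dist y \<rho> < d \<Longrightarrow>
      ?f y = eval_fps D (csqrt (1 - y / \<rho>))"
    using D(2) unfolding eventually_at by blast
  \<comment> \<open>Any \<open>s\<close> close enough to 1 works: there \<open>E s\<close> is a
    re-expansion of \<open>T\<close>, and \<open>x(y)\<close> is given by \<open>D\<close>, so the
    equation for \<open>E s\<close> can be rewritten as one for \<open>T\<close> and
    \<open>D\<close>.\<close>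
  obtain s where s: "0 < s" "s < 1" "dist (of_real s * \<rho>) \<rho> < d" "sqrt (1 - s) < e"
    and Es: "(\<lambda>w. eval_fps T (g s - ?\<tau> + w)) has_fps_expansion E s"
  proof -
    have "\<forall>\<^sub>F s in at (1::real) within {0..1}. (\<lambda>w. eval_fps T (g s - g 1 + w)) has_fps_expansion E s"
      using E(2)[of 1] E01 by (auto elim: eventually_mono)
    hence "\<forall>\<^sub>F s in at_left (1::real). (\<lambda>w. eval_fps T (g s - g 1 + w)) has_fps_expansion E s"
      by (simp add: at_within_Icc_at_left)
    moreover have "\<forall>\<^sub>F s in at_left (1::real). s \<in> {0<..<1}"
      by (rule eventually_at_left_real) simp
    moreover have "\<forall>\<^sub>F s in at_left (1::real). of_real s * \<rho> \<in> ball \<rho> d"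
    proof -
      have "((\<lambda>s. of_real s * \<rho>) \<longlongrightarrow> of_real 1 * \<rho>) (at_left (1::real))"
        by (intro tendsto_intros)
      from topological_tendstoD[OF this, of "ball \<rho> d"] d show ?thesis by simp
    qed
    moreover have "\<forall>\<^sub>F s in at_left (1::real). sqrt (1 - s) < e"
    proof -
      have "((\<lambda>s. sqrt (1 - s)) \<longlongrightarrow> sqrt (1 - 1)) (at_left (1::real))"
        by (intro tendsto_intros)
      from order_tendstoD(2)[OF this, of e] e(1) show ?thesis by simp
    qed
    ultimately have "\<forall>\<^sub>F s in at_left (1::real). (\<lambda>w. eval_fps T (g s - g 1 + w)) has_fps_expansion E s
        \<and> s \<in> {0<..<1} \<and> of_real s * \<rho> \<in> ball \<rho> d \<and> sqrt (1 - s) < e"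
      by eventually_elim simp
    then obtain s where "(\<lambda>w. eval_fps T (g s - g 1 + w)) has_fps_expansion E s
        \<and> s \<in> {0<..<1} \<and> of_real s * \<rho> \<in> ball \<rho> d \<and> sqrt (1 - s) < e"
      using eventually_happens'[OF trivial_limit_at_left_real] by blast
    thus ?thesis by (intro that[of s]) (auto simp: dist_commute g_def image_segment_def)
  qed
  define us where "us = complex_of_real (sqrt (1 - s))"
  have us: "us \<in> ball 0 e" "Re us > 0" "us\<^sup>2 = 1 - of_real s"
    using s by (auto simp: us_def simp flip: of_real_power)
  \<comment> \<open>On the right half-plane \<open>Y\<close> inverts the local parameter, and
    \<open>us\<close> is the parameter of \<open>s \<rho>\<close>.\<close>
  define Y where "Y = (\<lambda>u. \<rho> * (1 - u\<^sup>2))"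
  have Ys: "Y us = of_real s * \<rho>" by (simp add: Y_def us mult.commute)
  have Ycont: "(Y \<longlongrightarrow> Y us) (nhds us)"
    unfolding Y_def by (intro isCont_tendsto_nhds continuous_intros)
  have "\<forall>\<^sub>F u in nhds us. Y u \<in> ball 0 r \<inter> ball \<rho> d"
    by (rule topological_tendstoD[where l = "Y us"])
       (use s \<rho> in \<open>auto simp: Ys norm_mult dist_commute intro!: Ycont[unfolded Ys]\<close>)
  moreover have "\<forall>\<^sub>F u in nhds us. Re u > 0"
    using us by (intro eventually_nhds_in_open[of "{u. Re u > 0}", simplified] open_halfspace_Re_gt)
  ultimately have fD: "\<forall>\<^sub>F u in nhds us. ?f (Y u) = eval_fps D u"
  proof eventually_elim
    case (elim u)
    have "csqrt (1 - Y u / \<rho>) = u"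
      using elim(2) \<rho> by (auto simp: Y_def intro: csqrt_square)
    moreover have "Y u \<noteq> \<rho>" using elim(1) \<rho> by auto
    ultimately show ?case using d(2)[of "Y u"] elim(1) by (simp add: dist_commute)
  qed
  have gs: "g s = eval_fps D us"
    using eventually_nhds_x_imp_x[OF fD] s by (simp add: g Ys)
  have "\<forall>\<^sub>F u in nhds us. eval_fps (E s) (?f (Y u) - g s) = - ((Y u)\<^sup>2 / 2)"
  proof -
    have "filterlim Y (nhds (of_real s * \<rho>)) (nhds us)"
      unfolding Ys[symmetric] by (rule Ycont)
    from eventually_compose_filterlim[OF along this] show ?thesis using s by simp
  qed
  moreover have "\<forall>\<^sub>F u in nhds us. eval_fps (E s) (eval_fps D u - g s) =
      eval_fps T (g s - ?\<tau> + (eval_fps D u - g s))"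
  proof -
    have ev: "\<forall>\<^sub>F w in nhds 0. eval_fps (E s) w = eval_fps T (g s - ?\<tau> + w)"
      using Es unfolding has_fps_expansion_def by blast
    have "isCont (eval_fps D) us"
      using holomorphic_on_imp_continuous_on[OF Dhol] us(1)
      by (simp add: continuous_on_eq_continuous_at)
    hence "((\<lambda>u. eval_fps D u - g s) \<longlongrightarrow> eval_fps D us - g s) (nhds us)"
      by (intro tendsto_diff tendsto_const isCont_tendsto_nhds)
    hence "filterlim (\<lambda>u. eval_fps D u - g s) (nhds 0) (nhds us)" by (simp add: gs)
    from eventually_compose_filterlim[OF ev this] show ?thesis .
  qed
  moreover have "\<forall>\<^sub>F u in nhds us. u \<in> ball 0 e"
    using us by (intro eventually_nhds_in_open) auto
  ultimately have "\<forall>\<^sub>F u in nhds us. ?\<Phi> u = q u \<and> u \<in> ball 0 e"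
    using fD by eventually_elim (simp add: q_def Y_def power_mult_distrib)
  then obtain N where N: "open N" "us \<in> N" "\<And>u. u \<in> N \<Longrightarrow> ?\<Phi> u = q u \<and> u \<in> ball 0 e"
    unfolding eventually_nhds by blast
  \<comment> \<open>Both sides are holomorphic on a ball that contains \<open>us\<close> as well as
    0, so the equation passes from \<open>us\<close> to the branch point.\<close>
  have \<Phi>q: "?\<Phi> u = q u" if "u \<in> ball 0 e" for u
    by (rule analytic_continuation_open[of N "ball 0 e" ?\<Phi> q])
       (use N \<Phi> q that in auto)
  have exp: "(eval_fps T \<circ> (\<lambda>u. eval_fps D u - ?\<tau>)) has_fps_expansion (T oo (D - fps_const ?\<tau>))"
    using Trad D(1)
    by (intro has_fps_expansion_compose has_fps_expansion_diff has_fps_expansion_const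
          eval_fps_has_fps_expansion) auto
  have eq: "\<forall>\<^sub>F u in nhds 0. (eval_fps T \<circ> (\<lambda>u. eval_fps D u - ?\<tau>)) u = q u"
    using eventually_nhds_in_open[of "ball 0 e" 0] e(1) by (auto simp: \<Phi>q elim!: eventually_mono)
  have "q has_fps_expansion (T oo (D - fps_const ?\<tau>))"
    by (rule iffD1[OF has_fps_expansion_cong[OF eq refl] exp])
  moreover have "q has_fps_expansion fps_const (- (\<rho>\<^sup>2 / 2)) * (1 - fps_X ^ 2) ^ 2"
    unfolding q_def
    by (intro has_fps_expansion_cmult_left has_fps_expansion_power fps_expansion_intros)
  ultimately show ?thesis by (rule fps_expansion_unique_complex)
qed

subsection \<open>Asymptotics\<close>

lemma sum_even_odd:
  fixes f :: "nat \<Rightarrow> 'a :: comm_monoid_add"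
  shows "(\<Sum>i<2 * n. f i) = (\<Sum>k<n. f (2 * k)) + (\<Sum>k<n. f (2 * k + 1))"
  by (induction n) (simp_all add: algebra_simps)

text \<open>For \<open>y = \<rho> (1 - u^2)\<close> one has
  \<open>y^2 - \<rho>^2 = (\<i> \<rho>)^2 (2 u^2 - u^4)\<close>, so \<open>W\<close> is a root of it
  that is invertible as a series in \<open>u\<close>. Composing with its inverse replaces
  \<open>u\<close> by \<open>z\<close>. The linear coefficient of \<open>W\<close> is where the
  prescribed branch of the root of \<open>a_i\<close> comes from.\<close>

lemma reversion_at_branch_point:
  fixes T D :: "complex fps"
  assumes \<rho>: "\<rho> \<noteq> 0" and D1: "D $ 1 \<noteq> 0"
    and T: "T oo (D - fps_const (D $ 0)) = fps_const (- (\<rho>\<^sup>2 / 2)) * (1 - fps_X ^ 2) ^ 2"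
  defines "T0 \<equiv> T - fps_const (T $ 0)"
  obtains Z where
    "Z $ 0 = 0" "Z $ 1 = - \<i> * D $ 1 / (of_real (sqrt 2) * \<rho>)"
    "T0 oo Z = - (fps_const (1 / 2) * fps_X ^ 2)"
    "T $ 0 = - (\<rho>\<^sup>2 / 2)" "T0 $ 1 = 0" "T0 $ 2 \<noteq> 0"
    "D - fps_const (D $ 0) = Z oo (fps_const (\<i> * \<rho>) * sqrt_kernel_fps)"
proof -
  define D0 where "D0 = D - fps_const (D $ 0)"
  define W where "W = fps_const (\<i> * \<rho>) * sqrt_kernel_fps"
  define Z where "Z = D0 oo fps_inv W"
  have D00: "D0 $ 0 = 0" by (simp add: D0_def)
  have W0: "W $ 0 = 0" and W1: "W $ 1 = \<i> * \<rho> * of_real (sqrt 2)"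
    using sqrt_kernel_fps_1 by (simp_all add: W_def)
  have W1': "W $ 1 \<noteq> 0" unfolding W1 using \<rho> by simp
  have inv0: "fps_inv W $ 0 = 0" and inv1: "fps_inv W $ 1 = 1 / W $ 1"
    by (simp_all add: fps_inv_def)
  have T_0: "T $ 0 = - (\<rho>\<^sup>2 / 2)"
    using arg_cong[OF T, of "\<lambda>F. F $ 0"] by (simp add: fps_power_zeroth)
  have W2: "W ^ 2 = fps_const (- (\<rho>\<^sup>2)) * (2 * fps_X ^ 2 - fps_X ^ 4)"
    by (simp add: W_def power_mult_distrib sqrt_kernel_fps_square fps_const_power
          del: fps_const_neg)
  have "T0 oo D0 = fps_const (- (\<rho>\<^sup>2 / 2)) * (1 - fps_X ^ 2) ^ 2 - fps_const (- (\<rho>\<^sup>2 / 2))"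
    unfolding T0_def fps_compose_sub_distrib T[folded D0_def] T_0 by simp
  also have "\<dots> = - (fps_const (1 / 2) * W ^ 2)"
  proof -
    have "(1 - fps_X ^ 2) ^ 2 = 1 - (2 * fps_X ^ 2 - fps_X ^ 4 :: complex fps)"
      by (simp add: power2_diff flip: power_mult)
    moreover have "fps_const (1 / 2) * fps_const (- (\<rho>\<^sup>2)) = fps_const (- (\<rho>\<^sup>2 / 2))"
      by simp
    ultimately show ?thesis unfolding W2
      by (simp only: right_diff_distrib mult_1_right mult.assoc[symmetric]) simp
  qed
  finally have TD: "T0 oo D0 = - (fps_const (1 / 2) * W ^ 2)" .
  have "T0 oo Z = (T0 oo D0) oo fps_inv W"
    unfolding Z_def using D00 inv0 by (simp add: fps_compose_assoc)
  also have "\<dots> = - (fps_const (1 / 2) * (W oo fps_inv W) ^ 2)"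
    using inv0 by (simp add: TD fps_compose_uminus fps_compose_mult_distrib fps_compose_power)
  also have "W oo fps_inv W = fps_X" using W0 W1' by (intro fps_inv_right)
  finally have TZ: "T0 oo Z = - (fps_const (1 / 2) * fps_X ^ 2)" .
  have Z0: "Z $ 0 = 0" by (simp add: Z_def D00)
  have Z1: "Z $ 1 = D $ 1 / W $ 1"
    using inv1 by (simp add: Z_def fps_compose_nth D0_def)
  have Z1': "Z $ 1 \<noteq> 0" unfolding Z1 using D1 W1' by simp
  \<comment> \<open>That the recentred action has a nondegenerate critical point follows from the
    coefficients of exponents 1 and 2 in \<open>T0 oo Z\<close>, since \<open>Z $ 1\<close> is
    nonzero.\<close>
  have "(T0 oo Z) $ 1 = T0 $ 1 * Z $ 1" using Z0 by (simp add: fps_compose_nth)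
  hence T1: "T0 $ 1 = 0" using Z1' by (simp add: TZ)
  have "(T0 oo Z) $ 2 = T0 $ 2 * (Z $ 1) ^ 2"
    using Z0 T1 by (simp add: fps_compose_nth eval_nat_numeral fps_mult_nth)
  hence T2: "T0 $ 2 \<noteq> 0" by (auto simp: TZ)
  have "Z oo W = D0 oo (fps_inv W oo W)"
    unfolding Z_def using W0 inv0 by (simp add: fps_compose_assoc)
  also have "fps_inv W oo W = fps_X" using W0 W1' by (intro fps_inv)
  finally have "D0 = Z oo W" by simp
  moreover have "Z $ 1 = - \<i> * D $ 1 / (of_real (sqrt 2) * \<rho>)"
    unfolding Z1 W1 by (simp add: divide_simps)
  ultimately show ?thesis
    using that[of Z] Z0 TZ T_0 T1 T2 unfolding D0_def W_def by blast
qed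

text \<open>The square is a polynomial in \<open>u^2\<close>; even powers of \<open>z\<close> are
  therefore regular in \<open>y\<close>.\<close>

lemma sqrt_kernel_power_even_nth:
  assumes "odd n"
  shows "(sqrt_kernel_fps ^ (2 * k)) $ n = 0"
proof -
  have "sqrt_kernel_fps ^ (2 * k) = (fps_const 2 * fps_X - fps_X ^ 2) ^ k oo fps_X ^ 2"
  proof -
    have "(fps_const 2 * fps_X - fps_X ^ 2) oo fps_X ^ 2 = (2 * fps_X ^ 2 - fps_X ^ 4 :: complex fps)"
      by (simp add: fps_compose_sub_distrib fps_compose_mult_distrib fps_numeral_fps_const
            flip: fps_compose_power power_mult)
    thus ?thesis by (simp add: power_mult sqrt_kernel_fps_square flip: fps_compose_power)
  qed
  also have "\<dots> $ n = 0"
    using assms unfolding fps_compose_nth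
    by (intro sum.neutral) (auto simp: fps_X_power_nth simp flip: power_mult)
  finally show ?thesis .
qed

text \<open>The \<open>i\<close>-th power of the kernel starts at exponent \<open>i\<close>, so the
  sum may run up to the same \<open>K\<close> for every \<open>j\<close>. Hence one linear
  combination of comparison functions serves all exponents.\<close>

lemma odd_coeff_compose_sqrt_kernel:
  fixes Z :: "complex fps"
  assumes "j < K"
  shows "(Z oo (fps_const c * sqrt_kernel_fps)) $ (2 * j + 1) =
    (\<Sum>k<K. Z $ (2 * k + 1) * c ^ (2 * k + 1) * (sqrt_kernel_fps ^ (2 * k + 1)) $ (2 * j + 1))"
proof -
  let ?f = "\<lambda>i. Z $ i * (c ^ i * (sqrt_kernel_fps ^ i) $ (2 * j + 1))"
  have "(Z oo (fps_const c * sqrt_kernel_fps)) $ (2 * j + 1) = (\<Sum>i=0..2 * j + 1. ?f i)"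
    by (simp only: fps_compose_nth power_mult_distrib fps_const_power fps_mult_left_const_nth)
  also have "\<dots> = (\<Sum>i<2 * K. ?f i)"
    using assms by (intro sum.mono_neutral_left)
      (auto intro!: startsby_zero_power_prefix[OF sqrt_kernel_fps_0, rule_format])
  also have "\<dots> = (\<Sum>k<K. ?f (2 * k + 1))"
    unfolding sum_even_odd by (simp add: sqrt_kernel_power_even_nth del: power_Suc)
  finally show ?thesis by (simp only: mult.assoc)
qed

lemma fact_add_le_power: "fact (a + K) \<le> ((real a + real K) ^ K * fact a :: real)"
proof (induction K)
  case (Suc K)
  have "fact (a + Suc K) = (real a + real (Suc K)) * fact (a + K)" by simp
  also have "\<dots> \<le> (real a + real (Suc K)) * ((real a + real K) ^ K * fact a)"
    by (intro mult_left_mono Suc.IH) auto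
  also have "\<dots> \<le> (real a + real (Suc K)) * ((real a + real (Suc K)) ^ K * fact a)"
    by (intro mult_left_mono mult_right_mono power_mono) auto
  finally show ?case by (simp add: mult_ac)
qed simp

lemma odd_double_fact_Suc_le: "real (odd_double_fact (Suc n)) \<le> 2 ^ n * fact (Suc n)"
proof (induction n)
  case (Suc n)
  have "real (odd_double_fact (Suc (Suc n))) = real (odd_double_fact (Suc n)) * (2 * real n + 3)"
    by (simp add: odd_double_fact_Suc[of "Suc n"] algebra_simps)
  also have "\<dots> \<le> (2 ^ n * fact (Suc n)) * (2 * (real n + 2))"
    by (intro mult_mono Suc.IH) auto
  also have "\<dots> = 2 ^ Suc n * fact (Suc (Suc n))" by (simp add: algebra_simps)
  finally show ?case .
qed (simp add: odd_double_fact_def)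

text \<open>No error arises in passing from comparison functions to the stated terms: for
  \<open>l = n - k - 1\<close>, \<open>fact l\<close> is the Gamma value, and
  \<open>2^(l + 1)\<close> combines with the powers of \<open>\<rho>\<close> to a power of
  \<open>\<rho>^2 / 2\<close>.\<close>

lemma arcsin_kernel_term:
  fixes \<rho> z :: complex
  assumes \<rho>: "\<rho> \<noteq> 0" and n: "k < n"
  shows "of_nat (odd_double_fact (Suc n)) *
      (z * (\<i> * \<rho>) ^ (2 * k + 1) * (arcsin_kernel_fps k $ (2 * n + 1) / \<rho> ^ (2 * n + 1))) =
    1 / (2 * of_real pi * \<i>) * (of_nat (odd_double_fact (Suc k)) * z) *
      (\<rho>\<^sup>2 / 2) powi (- (int n - int k)) * Gamma (of_nat n - of_nat k)"
proof -
  define l where "l = n - k - 1"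
  have n': "n = k + 1 + l" using n by (simp add: l_def)
  have "of_nat n - of_nat k = (of_nat (Suc l) :: complex)" by (simp add: n')
  hence Gam: "Gamma (of_nat n - of_nat k :: complex) = fact l"
    by (metis Gamma_fact of_nat_Suc add.commute)
  have e: "- (int n - int k) = - int (Suc l)" by (simp add: n')
  have powi: "(\<rho>\<^sup>2 / 2) powi (- (int n - int k)) = 2 ^ Suc l / \<rho> ^ (2 * l + 2)"
  proof -
    have "2 * l + 2 = 2 * Suc l" by simp
    thus ?thesis
      by (simp only: e power_int_minus power_int_of_nat power_mult
           power_divide inverse_divide)
  qed
  have a: "of_nat (odd_double_fact (Suc n)) * arcsin_kernel_fps k $ (2 * n + 1) =
     (- 1) ^ (k + 1) * of_nat (odd_double_fact (Suc k)) * 2 ^ l * fact l / of_real pi"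
    using arcsin_kernel_fps_nth[of k l] by (simp add: n' del: power_Suc)
  \<comment> \<open>Origin of the prefactor: this \<open>- \<i>\<close>, the
    \<open>1 / \<pi>\<close> of the arcsine and the half in \<open>2^l = 2^(l + 1) / 2\<close>
    multiply to \<open>1 / (2 \<pi> \<i>)\<close>.\<close>
  have i: "\<i> ^ (2 * k + 1) * (- 1) ^ (k + 1) = - \<i>"
    by (simp add: power_mult power_add flip: power_mult_distrib)
  have "of_nat (odd_double_fact (Suc n)) *
      (z * (\<i> * \<rho>) ^ (2 * k + 1) * (arcsin_kernel_fps k $ (2 * n + 1) / \<rho> ^ (2 * n + 1))) =
    z * \<i> ^ (2 * k + 1) * (\<rho> ^ (2 * k + 1) / \<rho> ^ (2 * n + 1)) *
      (of_nat (odd_double_fact (Suc n)) * arcsin_kernel_fps k $ (2 * n + 1))"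
    by (simp add: power_mult_distrib mult_ac)
  also have "\<rho> ^ (2 * k + 1) / \<rho> ^ (2 * n + 1) = 1 / \<rho> ^ (2 * l + 2)"
  proof -
    have "\<rho> ^ (2 * n + 1) = \<rho> ^ (2 * k + 1) * \<rho> ^ (2 * l + 2)"
      unfolding n' power_add[symmetric] by (rule arg_cong[of _ _ "\<lambda>n. \<rho> ^ n"]) simp
    thus ?thesis using \<rho> by (simp del: power_Suc power_Suc2 add: divide_simps)
  qed
  also have "z * \<i> ^ (2 * k + 1) * (1 / \<rho> ^ (2 * l + 2)) *
      (of_nat (odd_double_fact (Suc n)) * arcsin_kernel_fps k $ (2 * n + 1)) =
      (\<i> ^ (2 * k + 1) * (- 1) ^ (k + 1)) *
      (z * of_nat (odd_double_fact (Suc k)) * 2 ^ l * fact l / (of_real pi * \<rho> ^ (2 * l + 2)))"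
    unfolding a by (simp add: mult_ac)
  also have "\<dots> = 1 / (2 * of_real pi * \<i>) * (of_nat (odd_double_fact (Suc k)) * z) *
      (2 ^ Suc l / \<rho> ^ (2 * l + 2)) * fact l"
  proof -
    have ii: "1 / (2 * of_real pi * \<i>) = - \<i> / (2 * of_real pi)" by (simp add: field_simps)
    show ?thesis unfolding i ii by (simp add: field_simps)
  qed
  finally show ?thesis unfolding powi Gam .
qed

text \<open>The weights of the comparison functions are the odd coefficients of \<open>Z i\<close>
  times powers of \<open>\<i> \<rho> i\<close>, exactly those in the expansion of
  \<open>D i\<close>. Subtraction cancels the first \<open>K\<close> odd coefficients at every point
  of the circle, as the Darboux bound requires.\<close>

lemma coeff_asymptotics:
  fixes F :: "complex fps" and D Z :: "'i \<Rightarrow> complex fps"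
  assumes sing: "dominant_sqrt_singularities F r I \<rho> D"
    and Z: "\<And>i. i \<in> I \<Longrightarrow> D i - fps_const (D i $ 0) = Z i oo (fps_const (\<i> * \<rho> i) * sqrt_kernel_fps)"
  shows "\<exists>B>0. \<forall>n. norm (F $ (n + K) -
      (\<Sum>k<K. \<Sum>i\<in>I. Z i $ (2 * k + 1) * (\<i> * \<rho> i) ^ (2 * k + 1) *
        (arcsin_kernel_fps k $ (n + K) / \<rho> i ^ (n + K)))) * (real n + 1) ^ K \<le> B / r ^ n"
proof -
  have r: "r > 0" and rad: "fps_conv_radius F = ereal r" and I: "finite I" "inj_on \<rho> I"
    and \<rho>: "\<And>i. i \<in> I \<Longrightarrow> norm (\<rho> i) = r"
    using sing unfolding dominant_sqrt_singularities_def by blast+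
  have \<rho>0: "\<rho> i \<noteq> 0" if "i \<in> I" for i using \<rho>[OF that] r by auto
  define C where "C = (\<lambda>k i. Z i $ (2 * k + 1) * (\<i> * \<rho> i) ^ (2 * k + 1))"
  define h where "h = (\<lambda>y. eval_fps F y - (\<Sum>k<K. \<Sum>i\<in>I. C k i * arcsin_kernel k (y / \<rho> i)))"
  define H where "H = F - (\<Sum>k<K. \<Sum>i\<in>I. fps_const (C k i) *
      (arcsin_kernel_fps k oo (fps_const (1 / \<rho> i) * fps_X)))"
  have f: "eval_fps F holomorphic_on ball 0 r"
    using rad by (intro holomorphic_on_eval_fps) auto
  have scaled: "(\<lambda>y. arcsin_kernel k (y / \<rho> i)) holomorphic_on ball 0 r" if "i \<in> I" for k i
  proof -
    have "(arcsin_kernel k \<circ> (\<lambda>y. y / \<rho> i)) holomorphic_on ball 0 r"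
      using \<rho>[OF that] \<rho>0[OF that] ball_subset_double_slit_plane
      by (intro holomorphic_on_compose_gen[OF _ arcsin_kernel_holomorphic] holomorphic_intros)
         (auto simp: subset_iff norm_divide)
    thus ?thesis by (simp add: o_def)
  qed
  have h: "h holomorphic_on ball 0 r"
    unfolding h_def by (intro holomorphic_intros f scaled)
  have hH: "h has_fps_expansion H"
    unfolding h_def H_def
  proof (intro has_fps_expansion_diff has_fps_expansion_sum has_fps_expansion_cmult_left)
    show "eval_fps F has_fps_expansion F"
      using rad r by (intro eval_fps_has_fps_expansion) simp
    fix k i assume "i \<in> I"
    have "(\<lambda>y. 1 / \<rho> i * y) has_fps_expansion fps_const (1 / \<rho> i) * fps_X"
      by (intro has_fps_expansion_cmult_left has_fps_expansion_fps_X)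
    from has_fps_expansion_compose[OF arcsin_kernel_has_fps_expansion this]
    show "(\<lambda>y. arcsin_kernel k (y / \<rho> i)) has_fps_expansion
        (arcsin_kernel_fps k oo (fps_const (1 / \<rho> i) * fps_X))"
      by (simp add: o_def)
  qed
  \<comment> \<open>The point \<open>- \<rho> i\<close> may be another singularity; there the comparison functions contribute
    only even powers of the local parameter.\<close>
  have "\<exists>P. sqrt_expansion h \<zeta> P \<and> (\<forall>j<K. P $ (2 * j + 1) = 0)" if \<zeta>: "norm \<zeta> = r" for \<zeta>
  proof -
    have \<zeta>0: "\<zeta> \<noteq> 0" using \<zeta> r by auto
    define expands where "expands = (\<lambda>k i Q. sqrt_expansion (\<lambda>y. arcsin_kernel k (y / \<rho> i)) \<zeta> Q \<and>
        (\<forall>n. odd n \<longrightarrow> Q $ n = (if \<zeta> = \<rho> i then (sqrt_kernel_fps ^ (2 * k + 1)) $ n else 0)))"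
    have ex: "\<exists>Q. expands k i Q" if i: "i \<in> I" for k i
    proof (cases "\<zeta> = \<rho> i \<or> \<zeta> = - \<rho> i")
      case True
      obtain E where E: "sqrt_expansion (\<lambda>y. arcsin_kernel k (y / \<rho> i)) (\<rho> i)
            (sqrt_kernel_fps ^ (2 * k + 1) - E)"
          "sqrt_expansion (\<lambda>y. arcsin_kernel k (y / \<rho> i)) (- \<rho> i) E"
          "\<And>n. odd n \<Longrightarrow> E $ n = 0"
        using arcsin_kernel_sqrt_expansion[OF \<rho>0[OF i]] by metis
      show ?thesis
      proof (cases "\<zeta> = \<rho> i")
        case True
        thus ?thesis using E(1,3) unfolding expands_def
          by (intro exI[of _ "sqrt_kernel_fps ^ (2 * k + 1) - E"]) simp
      next
        case False
        thus ?thesis using E(2,3) True unfolding expands_def by (intro exI[of _ E]) auto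
      qed
    next
      case False
      then obtain P where "sqrt_expansion (\<lambda>y. arcsin_kernel k (y / \<rho> i)) \<zeta> P"
          "\<And>n. odd n \<Longrightarrow> P $ n = 0"
        using arcsin_kernel_sqrt_expansion_regular[of \<zeta> "\<rho> i" k] \<rho>[OF i] \<rho>0[OF i] \<zeta> by auto
      thus ?thesis using False unfolding expands_def by (intro exI[of _ P]) simp
    qed
    define Q where "Q = (\<lambda>k i. SOME Q. expands k i Q)"
    have Q: "\<And>i k. i \<in> I \<Longrightarrow> sqrt_expansion (\<lambda>y. arcsin_kernel k (y / \<rho> i)) \<zeta> (Q k i)"
      "\<And>i k n. i \<in> I \<Longrightarrow> odd n \<Longrightarrow>
         Q k i $ n = (if \<zeta> = \<rho> i then (sqrt_kernel_fps ^ (2 * k + 1)) $ n else 0)"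
      using someI_ex[OF ex] unfolding Q_def expands_def by blast+
    have "\<exists>P. sqrt_expansion (eval_fps F) \<zeta> P \<and> (\<forall>j<K. P $ (2 * j + 1) =
        (\<Sum>k<K. \<Sum>i\<in>I. C k i * Q k i $ (2 * j + 1)))"
    proof (cases "\<zeta> \<in> \<rho> ` I")
      case True
      then obtain i where i: "i \<in> I" "\<zeta> = \<rho> i" by blast
      have "0 < fps_conv_radius (D i)" and "\<forall>\<^sub>F y in at (\<rho> i) within ball 0 r.
          eval_fps F y = eval_fps (D i) (csqrt (1 - y / \<rho> i))"
        using sing i(1) unfolding dominant_sqrt_singularities_def by blast+
      hence "sqrt_expansion (eval_fps F) \<zeta> (D i)"
        using \<zeta> i(2) by (intro sqrt_expansionI[OF eval_fps_has_fps_expansion]) simp_all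
      moreover have "D i $ (2 * j + 1) = (\<Sum>k<K. \<Sum>i\<in>I. C k i * Q k i $ (2 * j + 1))"
        if j: "j < K" for j
      proof -
        have "D i $ (2 * j + 1) = (D i - fps_const (D i $ 0)) $ (2 * j + 1)" by simp
        also have "\<dots> = (\<Sum>k<K. C k i * (sqrt_kernel_fps ^ (2 * k + 1)) $ (2 * j + 1))"
          unfolding Z[OF i(1)] C_def by (rule odd_coeff_compose_sqrt_kernel[OF j])
        \<comment> \<open>As \<open>\<rho>\<close> is injective, at this point only the comparison
          functions belonging to \<open>i\<close> have odd coefficients.\<close>
        also have "\<dots> = (\<Sum>k<K. \<Sum>i'\<in>I. if i' = i then
            C k i' * (sqrt_kernel_fps ^ (2 * k + 1)) $ (2 * j + 1) else 0)"
          using I i by (simp del: power_Suc)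
        also have "\<dots> = (\<Sum>k<K. \<Sum>i'\<in>I. C k i' * Q k i' $ (2 * j + 1))"
          using I(2) i by (intro sum.cong refl) (auto simp: Q(2) inj_on_eq_iff simp del: power_Suc)
        finally show ?thesis .
      qed
      ultimately show ?thesis by blast
    next
      case False
      obtain e g where "e > 0" "g holomorphic_on ball \<zeta> e"
          "\<forall>y \<in> ball \<zeta> e \<inter> ball 0 r. g y = eval_fps F y"
        using sing \<zeta> False unfolding dominant_sqrt_singularities_def by blast
      then obtain P where "sqrt_expansion (eval_fps F) \<zeta> P" "\<And>n. odd n \<Longrightarrow> P $ n = 0"
        using sqrt_expansion_holomorphic[OF \<zeta>0, of e g "eval_fps F"] \<zeta> by metis
      moreover have "(\<Sum>k<K. \<Sum>i\<in>I. C k i * Q k i $ (2 * j + 1)) = 0" for j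
        using False by (intro sum.neutral ballI) (auto simp: Q(2))
      ultimately show ?thesis by auto
    qed
    then obtain P where P: "sqrt_expansion (eval_fps F) \<zeta> P" "\<And>j. j < K \<Longrightarrow> P $ (2 * j + 1) =
        (\<Sum>k<K. \<Sum>i\<in>I. C k i * Q k i $ (2 * j + 1))" by blast
    have "sqrt_expansion h \<zeta> (P - (\<Sum>k<K. \<Sum>i\<in>I. fps_const (C k i) * Q k i))"
      unfolding h_def
      by (intro sqrt_expansion_diff sqrt_expansion_sum sqrt_expansion_cmult P(1) Q(1) I finite_lessThan)
    moreover have "(P - (\<Sum>k<K. \<Sum>i\<in>I. fps_const (C k i) * Q k i)) $ (2 * j + 1) = 0" if "j < K" for j
      using P(2)[OF that] by (simp add: fps_sum_nth)
    ultimately show ?thesis by blast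
  qed
  then obtain B where B: "B > 0" "\<And>n. norm (H $ (n + K)) * (real n + 1) ^ K \<le> B / r ^ n"
    using darboux_coeff_bound[OF h r hH] by metis
  have "H $ n = F $ n - (\<Sum>k<K. \<Sum>i\<in>I. C k i * (arcsin_kernel_fps k $ n / \<rho> i ^ n))" for n
    unfolding H_def fps_compose_linear by (simp add: fps_sum_nth power_one_over field_simps)
  thus ?thesis using B unfolding C_def by (intro exI[of _ B]) simp
qed

theorem theorem2p1:
  fixes S X :: "real fps"
    and r :: real
    and I :: "'i set"
    and \<rho> \<tau> A :: "'i \<Rightarrow> complex"
    and D T :: "'i \<Rightarrow> complex fps"
    and w :: "'i \<Rightarrow> nat \<Rightarrow> complex"
    and R :: nat
  assumes S: "fps_nth S 0 = 0" "fps_nth S 1 = 0" "fps_nth S 2 < 0"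
    and X: "fps_nth X 0 = 0" "fps_nth X 1 > 0" "fps_const (1 / 2) * fps_X ^ 2 = - (S oo X)"
    and sing: "dominant_sqrt_singularities (complex_fps X) r I \<rho> D"
    and \<tau>: "\<And>i. i \<in> I \<Longrightarrow> \<tau> i = fps_nth (D i) 0"
    \<comment> \<open>T i is the Taylor series of S at the point \<tau> i\<close>
    and T: "\<And>i. i \<in> I \<Longrightarrow>
      analytic_continuation_along (image_segment (complex_fps X) (\<rho> i) (\<tau> i))
        (complex_fps S) (T i)"
    and A: "\<And>i. i \<in> I \<Longrightarrow> A i = - fps_nth (T i) 0"
    and w: "\<And>i k. i \<in> I \<Longrightarrow> w i k =
      1 / (2 * of_real pi * \<i>) *
      fls_nth (formal_integral (- \<i> * fps_nth (D i) 1 / (of_real (sqrt 2) * \<rho> i))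
        (T i - fps_const (fps_nth (T i) 0))) (int k)"
  shows "(\<lambda>n. fls_nth (formal_integral (of_real (sqrt (- 1 / (2 * fps_nth S 2))))
                 (complex_fps S)) (int n)
             - (\<Sum>k<R. \<Sum>i\<in>I. w i k * A i powi (- (int n - int k)) * Gamma (of_nat n - of_nat k)))
         \<in> O(\<lambda>n. of_real (\<Sum>i\<in>I. norm (A i) powi (- int n) * Gamma (real n - real R)))"
proof -
  define F where "F = complex_fps X"
  \<comment> \<open>Up to geometric factors the remainder is at most \<open>(n + 1)!\<close> over
    \<open>(n + 1)^K\<close>. To compare it with \<open>Gamma (n - R) = (n - R - 1)!\<close> one
    needs \<open>(n - R - 1) + K = n + 1\<close>.\<close>
  define K where "K = R + 2"
  have r: "r > 0" and rad: "fps_conv_radius F = ereal r" and I: "finite I" "I \<noteq> {}"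
    and \<rho>: "\<And>i. i \<in> I \<Longrightarrow> norm (\<rho> i) = r"
    and D: "\<And>i. i \<in> I \<Longrightarrow> 0 < fps_conv_radius (D i)" "\<And>i. i \<in> I \<Longrightarrow> D i $ 1 \<noteq> 0"
      "\<And>i. i \<in> I \<Longrightarrow> \<forall>\<^sub>F y in at (\<rho> i) within ball 0 r.
        eval_fps F y = eval_fps (D i) (csqrt (1 - y / \<rho> i))"
    using sing unfolding dominant_sqrt_singularities_def F_def by blast+
  have \<rho>0: "\<rho> i \<noteq> 0" if "i \<in> I" for i using \<rho>[OF that] r by auto
  have F01: "F $ 0 = 0" "F $ 1 \<noteq> 0" using X by (simp_all add: F_def)
  have SX: "S oo X = - (fps_const (1 / 2) * fps_X ^ 2)" using X(3) by simp
  have SF: "complex_fps S oo F = - (fps_const (1 / 2) * fps_X ^ 2)"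
    unfolding F_def complex_fps_compose[symmetric] SX
    by (auto simp: fps_eq_iff fps_X_power_nth)
  have "\<exists>Z. Z $ 0 = 0 \<and> Z $ 1 = - \<i> * D i $ 1 / (of_real (sqrt 2) * \<rho> i) \<and>
      (T i - fps_const (T i $ 0)) oo Z = - (fps_const (1 / 2) * fps_X ^ 2) \<and>
      T i $ 0 = - ((\<rho> i)\<^sup>2 / 2) \<and> (T i - fps_const (T i $ 0)) $ 1 = 0 \<and>
      (T i - fps_const (T i $ 0)) $ 2 \<noteq> 0 \<and>
      D i - fps_const (D i $ 0) = Z oo (fps_const (\<i> * \<rho> i) * sqrt_kernel_fps)"
    if i: "i \<in> I" for i
  proof -
    have "T i oo (D i - fps_const (D i $ 0)) = fps_const (- ((\<rho> i)\<^sup>2 / 2)) * (1 - fps_X ^ 2) ^ 2"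
      using T[OF i] unfolding \<tau>[OF i] F_def[symmetric]
      by (rule continuation_at_branch_point[OF F01(1) SF rad \<rho>[OF i] r D(1)[OF i] D(3)[OF i]])
    thus ?thesis by (rule reversion_at_branch_point[OF \<rho>0[OF i] D(2)[OF i]]) blast
  qed
  then obtain Z where Z: "\<forall>i\<in>I. Z i $ 0 = 0 \<and>
      Z i $ 1 = - \<i> * D i $ 1 / (of_real (sqrt 2) * \<rho> i) \<and>
      (T i - fps_const (T i $ 0)) oo Z i = - (fps_const (1 / 2) * fps_X ^ 2) \<and>
      T i $ 0 = - ((\<rho> i)\<^sup>2 / 2) \<and> (T i - fps_const (T i $ 0)) $ 1 = 0 \<and>
      (T i - fps_const (T i $ 0)) $ 2 \<noteq> 0 \<and>
      D i - fps_const (D i $ 0) = Z i oo (fps_const (\<i> * \<rho> i) * sqrt_kernel_fps)"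
    by (metis (no_types, lifting))
  have ZD: "\<And>i. i \<in> I \<Longrightarrow>
      D i - fps_const (D i $ 0) = Z i oo (fps_const (\<i> * \<rho> i) * sqrt_kernel_fps)"
    using Z by blast
  have A\<rho>: "A i = (\<rho> i)\<^sup>2 / 2" if "i \<in> I" for i
    using A[OF that] Z that by simp
  define \<alpha> where "\<alpha> = r\<^sup>2 / 2"
  have \<alpha>: "\<alpha> > 0" using r by (simp add: \<alpha>_def)
  \<comment> \<open>The singular points share a circle, so the error sum consists of equal terms and
    is \<open>card I\<close> times the sequence \<open>a\<close> below.\<close>
  have A\<alpha>: "norm (A i) = \<alpha>" if "i \<in> I" for i
    using \<rho>[OF that] by (simp add: A\<rho>[OF that] norm_divide norm_power \<alpha>_def)
  have wZ: "w i k = 1 / (2 * of_real pi * \<i>) * (of_nat (odd_double_fact (Suc k)) * Z i $ (2 * k + 1))"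
    if i: "i \<in> I" for i k
  proof -
    have "- \<i> * D i $ 1 / (of_real (sqrt 2) * \<rho> i) = Z i $ 1" using Z i by simp
    moreover have "Z i $ 1 \<noteq> 0"
      using calculation D(2)[OF i] \<rho>0[OF i] by (metis complex_i_not_zero divide_eq_0_iff
          mult_eq_0_iff neg_equal_0_iff_equal of_real_eq_0_iff real_sqrt_eq_zero_cancel_iff
          zero_neq_numeral)
    hence "fls_nth (formal_integral (Z i $ 1) (T i - fps_const (T i $ 0))) (int k) =
        of_nat (odd_double_fact (Suc k)) * Z i $ (2 * k + 1)"
      using Z i by (intro formal_integral_nth_eq_reversion) auto
    ultimately show ?thesis unfolding w[OF i] by simp
  qed
  define G where "G = (\<lambda>n. fls_nth (formal_integral (of_real (sqrt (- 1 / (2 * S $ 2))))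
      (complex_fps S)) (int n))"
  have G: "G n = of_nat (odd_double_fact (Suc n)) * F $ (2 * n + 1)" for n
  proof -
    have "(S oo X) $ 2 = S $ 2 * (X $ 1)\<^sup>2"
      using X(1) S(2) by (simp add: fps_compose_nth eval_nat_numeral fps_mult_nth)
    hence "S $ 2 * (X $ 1)\<^sup>2 = - (1 / 2)" unfolding SX by simp
    hence "- 1 / (2 * S $ 2) = (X $ 1)\<^sup>2" using S(3) by (simp add: field_simps)
    \<comment> \<open>The positive linear coefficient of \<open>X\<close> selects the positive
      root.\<close>
    hence "of_real (sqrt (- 1 / (2 * S $ 2))) = F $ 1"
      using X(2) by (simp add: F_def real_sqrt_unique)
    thus ?thesis unfolding G_def
      using formal_integral_nth_eq_reversion[of "complex_fps S" F n] S SF F01 by simp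
  qed
  define t where "t = (\<lambda>n k i. w i k * A i powi (- (int n - int k)) * Gamma (of_nat n - of_nat k))"
  obtain B where B: "B > 0" "\<And>n. norm (F $ (n + K) -
      (\<Sum>k<K. \<Sum>i\<in>I. Z i $ (2 * k + 1) * (\<i> * \<rho> i) ^ (2 * k + 1) *
        (arcsin_kernel_fps k $ (n + K) / \<rho> i ^ (n + K)))) * (real n + 1) ^ K \<le> B / r ^ n"
    using coeff_asymptotics[OF sing[folded F_def] ZD, of K] by blast
  define a where "a = (\<lambda>n. inverse \<alpha> ^ n * fact (n - R - 1))"
  have remainder: "norm (G n - (\<Sum>k<K. \<Sum>i\<in>I. t n k i)) \<le> B * r ^ K / r * a n" if n: "n \<ge> K" for n
  proof -
    define m where "m = 2 * n + 1 - K"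
    have m: "2 * n + 1 = m + K" using n by (simp add: m_def)
    define H where "H = F $ (2 * n + 1) -
      (\<Sum>k<K. \<Sum>i\<in>I. Z i $ (2 * k + 1) * (\<i> * \<rho> i) ^ (2 * k + 1) *
        (arcsin_kernel_fps k $ (2 * n + 1) / \<rho> i ^ (2 * n + 1)))"
    have "t n k i = of_nat (odd_double_fact (Suc n)) * (Z i $ (2 * k + 1) * (\<i> * \<rho> i) ^ (2 * k + 1) *
        (arcsin_kernel_fps k $ (2 * n + 1) / \<rho> i ^ (2 * n + 1)))" if "k < K" "i \<in> I" for k i
      using arcsin_kernel_term[OF \<rho>0, of i k n "Z i $ (2 * k + 1)"] that n
      by (simp only: t_def wZ A\<rho> less_le_trans)
    hence "G n - (\<Sum>k<K. \<Sum>i\<in>I. t n k i) = of_nat (odd_double_fact (Suc n)) * H"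
      unfolding G H_def by (simp add: right_diff_distrib sum_distrib_left)
    hence norm_eq: "norm (G n - (\<Sum>k<K. \<Sum>i\<in>I. t n k i)) = real (odd_double_fact (Suc n)) * norm H"
      by (simp add: norm_mult)
    have "real (odd_double_fact (Suc n)) \<le> 2 ^ n * fact (Suc n)"
      by (rule odd_double_fact_Suc_le)
    also have "fact (Suc n) \<le> (real m + 1) ^ K * fact (n - R - 1)"
    proof -
      have "n - R - 1 + K = Suc n" using n by (simp add: K_def)
      hence "fact (Suc n) \<le> (real (Suc n)) ^ K * (fact (n - R - 1) :: real)"
        using fact_add_le_power[of "n - R - 1" K] by (metis of_nat_add)
      \<comment> \<open>From \<open>n >= K\<close> it follows that \<open>m >= n\<close>.\<close>
      also have "\<dots> \<le> (real m + 1) ^ K * fact (n - R - 1)"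
        using n by (intro mult_right_mono power_mono) (auto simp: m_def)
      finally show ?thesis .
    qed
    finally have "real (odd_double_fact (Suc n)) * norm H \<le>
        2 ^ n * ((real m + 1) ^ K * fact (n - R - 1)) * norm H"
      by (intro mult_right_mono) (auto simp: mult_left_mono)
    also have "\<dots> = 2 ^ n * fact (n - R - 1) * (norm H * (real m + 1) ^ K)" by simp
    also have "\<dots> \<le> 2 ^ n * fact (n - R - 1) * (B / r ^ m)"
      using B(2)[of m] unfolding H_def m by (intro mult_left_mono) auto
    also have "\<dots> = B * fact (n - R - 1) * 2 ^ n * (1 / r ^ m)" by simp
    also have "1 / r ^ m = r ^ K / r * (1 / (r\<^sup>2) ^ n)"
    proof -
      have "r ^ m * r ^ K = r * (r\<^sup>2) ^ n"
        unfolding power_add[symmetric] m[symmetric] by (simp add: power_mult)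
      thus ?thesis using r by (simp add: field_simps)
    qed
    also have "B * fact (n - R - 1) * 2 ^ n * \<dots> =
        B * r ^ K / r * (fact (n - R - 1) * (2 ^ n / (r\<^sup>2) ^ n))" by simp
    also have "2 ^ n / (r\<^sup>2) ^ n = inverse \<alpha> ^ n"
      by (simp add: \<alpha>_def power_divide)
    finally show ?thesis unfolding norm_eq a_def by (simp add: mult_ac)
  qed
  \<comment> \<open>The surplus terms \<open>k = R\<close> and \<open>k = R + 1\<close> have at most
    the order of the error, since the factorial in them does not exceed the one in
    \<open>a n\<close>.\<close>
  have extra: "norm (t n k i) \<le> norm (w i k) * \<alpha> ^ k * a n"
    if "n \<ge> K" "R \<le> k" "k < K" "i \<in> I" for n k i
  proof -
    have "of_nat n - of_nat k = (of_nat (Suc (n - k - 1)) :: complex)" using that by (simp add: of_nat_diff)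
    hence "Gamma (of_nat n - of_nat k :: complex) = fact (n - k - 1)"
      by (metis Gamma_fact of_nat_Suc add.commute)
    moreover have "norm (A i powi (- (int n - int k))) = inverse \<alpha> ^ n * \<alpha> ^ k"
      using \<alpha> A\<alpha>[OF that(4)] by (simp add: norm_power_int power_int_diff power_int_minus power_inverse divide_inverse)
    ultimately have "norm (t n k i) = norm (w i k) * (inverse \<alpha> ^ n * \<alpha> ^ k) * fact (n - k - 1)"
      by (simp add: t_def norm_mult)
    also have "\<dots> \<le> norm (w i k) * (inverse \<alpha> ^ n * \<alpha> ^ k) * fact (n - R - 1)"
      using that \<alpha> by (intro mult_left_mono fact_mono) auto
    finally show ?thesis by (simp add: a_def mult_ac)
  qed
  define c where "c = B * r ^ K / r + (\<Sum>k=R..<K. \<Sum>i\<in>I. norm (w i k) * \<alpha> ^ k)"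
  have main: "norm (G n - (\<Sum>k<R. \<Sum>i\<in>I. t n k i)) \<le> c * a n" if n: "n \<ge> K" for n
  proof -
    have "(\<Sum>k<K. \<Sum>i\<in>I. t n k i) = (\<Sum>k<R. \<Sum>i\<in>I. t n k i) + (\<Sum>k=R..<K. \<Sum>i\<in>I. t n k i)"
      unfolding lessThan_atLeast0 by (rule sum.atLeastLessThan_concat[symmetric]) (auto simp: K_def)
    hence "G n - (\<Sum>k<R. \<Sum>i\<in>I. t n k i) =
        (G n - (\<Sum>k<K. \<Sum>i\<in>I. t n k i)) + (\<Sum>k=R..<K. \<Sum>i\<in>I. t n k i)" by simp
    also have "norm \<dots> \<le> B * r ^ K / r * a n + (\<Sum>k=R..<K. \<Sum>i\<in>I. norm (w i k) * \<alpha> ^ k * a n)"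
      using n by (intro norm_triangle_mono remainder sum_norm_le extra) auto
    finally show ?thesis by (simp add: c_def distrib_right sum_distrib_right)
  qed
  have target: "a n \<le> norm (of_real (\<Sum>i\<in>I. norm (A i) powi (- int n) * Gamma (real n - real R)) :: complex)"
    if n: "n \<ge> K" for n
  proof -
    have "real n - real R = real (Suc (n - R - 1))" using n by (simp add: K_def of_nat_diff)
    hence "Gamma (real n - real R) = fact (n - R - 1)"
      by (metis Gamma_fact of_nat_Suc add.commute)
    hence eq: "(\<Sum>i\<in>I. norm (A i) powi (- int n) * Gamma (real n - real R)) = real (card I) * a n"
      by (simp add: A\<alpha> a_def power_int_minus power_inverse)
    \<comment> \<open>A nonempty \<open>I\<close> makes the error sum at least one copy of
      \<open>a n\<close>.\<close>
    have "real (card I) \<ge> 1" using I by (simp add: Suc_le_eq card_gt_0_iff)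
    moreover have "a n \<ge> 0" using \<alpha> by (simp add: a_def)
    ultimately have "1 * a n \<le> real (card I) * a n" by (rule mult_right_mono)
    thus ?thesis unfolding eq norm_of_real by linarith
  qed
  show ?thesis
  proof (rule bigoI)
    show "\<forall>\<^sub>F n in at_top. norm (fls_nth (formal_integral (of_real (sqrt (- 1 / (2 * fps_nth S 2))))
                 (complex_fps S)) (int n)
             - (\<Sum>k<R. \<Sum>i\<in>I. w i k * A i powi (- (int n - int k)) * Gamma (of_nat n - of_nat k)))
        \<le> c * norm (of_real (\<Sum>i\<in>I. norm (A i) powi (- int n) * Gamma (real n - real R)) :: complex)"
      using eventually_ge_at_top[of K]
    proof eventually_elim
      case (elim n)
      have "c \<ge> 0" unfolding c_def using B(1) r \<alpha> by (intro add_nonneg_nonneg sum_nonneg) auto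
      hence "c * a n \<le> c * norm (of_real (\<Sum>i\<in>I. norm (A i) powi (- int n) * Gamma (real n - real R)) :: complex)"
        by (intro mult_left_mono target elim)
      with main[OF elim] show ?case unfolding G_def t_def by (rule order.trans)
    qed
  qed
qed

end
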